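(* Let $M=(M,d_M)$ and $N=(N,d_N)$ be complete filtered chain complexes and $(F,G,H,L)$ a chain homotopy equivalence, i.e. $F:M\to N$, $G:N\to M$ of degree $0$ and $H:M\to M$, $L:N\to N$ of degree $1$ are filtration-preserving maps with $$Fd_M=d_NF,\quad Gd_N=d_MG,\quad GF-1_M=d_MH+Hd_M,\quad FG-1_N=d_NL+Ld_N .$$ Given a perturbation $\tilde d_M$ of $d_M$, there exist a perturbation $\tilde d_N'$ of the differential $d_N$ and a chain homotopy equivalence $(\tilde F',\tilde G',\tilde H',\tilde L')$ of the perturbed complexes $(M,\tilde d_M)$ and $(N,\tilde d_N')$ that is a perturbation of $(F,G,H,L-F(GL-HG))$.
   Context: Chain complexes are $\mathbb Z$-graded complexes of abelian groups with differential of degree $-1$. A filtration of a chain complex $M$ is a descending sequence $M=F^0M\supset F^1M\supset\cdots$ of subcomplexes; it is complete if (in each degree) $M\to\varprojlim_p M/F^pM$ is an isomorphism. Maps of filtered complexes are required to preserve filtrations. A linear map $g:M\to N$ is a perturbation of $f:M\to N$ of the same degree if $(f-g)(F^pM)\subset F^{p+1}N$ for all $p\ge0$. A perturbation of a differential $d$ is a perturbation $\tilde d$ of the map $d$ with $\tilde d^2=0$. A perturbation of a quadruple of maps is a quadruple of perturbations of the respective maps. A chain homotopy equivalence of $(M,\tilde d_M)$ and $(N,\tilde d'_N)$ is a quadruple satisfying the displayed four equations with respect to these differentials. *)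

theory Defs
  imports "HOL-Algebra.Algebra"
begin

text \<open>
  A graded abelian group is a family \<open>M :: int \<Rightarrow> _ monoid\<close> of commutative groups, written
  multiplicatively as everywhere in the group theory of HOL-Algebra: \<open>\<otimes>\<close> is the addition,
  \<open>\<one>\<close> the zero and \<open>x \<otimes> inv y\<close> the difference. A map of degree \<open>k\<close> is a family \<open>f\<close> whose
  \<open>n\<close>-th member goes from \<open>M n\<close> to \<open>N (n + k)\<close>; only its values on the carriers matter.
\<close>

definition graded_hom ::
  "int \<Rightarrow> (int \<Rightarrow> ('a, 'm) monoid_scheme) \<Rightarrow> (int \<Rightarrow> ('b, 'n) monoid_scheme)
     \<Rightarrow> (int \<Rightarrow> 'a \<Rightarrow> 'b) set"
  where "graded_hom k M N = {f. \<forall>n. f n \<in> hom (M n) (N (n + k))}"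

definition square_zero ::
  "(int \<Rightarrow> ('a, 'm) monoid_scheme) \<Rightarrow> (int \<Rightarrow> 'a \<Rightarrow> 'a) \<Rightarrow> bool"
  where "square_zero M d \<longleftrightarrow> (\<forall>n. \<forall>x\<in>carrier (M n). d (n - 1) (d n x) = \<one>\<^bsub>M (n - 2)\<^esub>)"

definition chain_complex ::
  "(int \<Rightarrow> ('a, 'm) monoid_scheme) \<Rightarrow> (int \<Rightarrow> 'a \<Rightarrow> 'a) \<Rightarrow> bool"
  where "chain_complex M d \<longleftrightarrow>
    (\<forall>n. comm_group (M n)) \<and> d \<in> graded_hom (- 1) M M \<and> square_zero M d"

text \<open>In a filtration \<open>A\<close> of \<open>M\<close>, the set \<open>A p n\<close> is the degree \<open>n\<close> part of \<open>F\<^sup>pM\<close>.\<close>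

definition filtration ::
  "(int \<Rightarrow> ('a, 'm) monoid_scheme) \<Rightarrow> (int \<Rightarrow> 'a \<Rightarrow> 'a) \<Rightarrow> (nat \<Rightarrow> int \<Rightarrow> 'a set) \<Rightarrow> bool"
  where "filtration M d A \<longleftrightarrow>
    (\<forall>p n. subgroup (A p n) (M n)) \<and>
    (\<forall>p n. d n ` A p n \<subseteq> A p (n - 1)) \<and>
    (\<forall>n. A 0 n = carrier (M n)) \<and>
    (\<forall>p n. A (Suc p) n \<subseteq> A p n)"

definition inverse_limit ::
  "(nat \<Rightarrow> ('a, 'm) monoid_scheme) \<Rightarrow> (nat \<Rightarrow> 'a \<Rightarrow> 'a) \<Rightarrow> (nat \<Rightarrow> 'a) monoid"
  where "inverse_limit Q t =
    (product_group UNIV Q)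
      \<lparr>carrier := {s \<in> carrier (product_group UNIV Q). \<forall>p. t p (s (Suc p)) = s p}\<rparr>"

text \<open>
  The transition map from the quotient by \<open>A (Suc p) n\<close> to the quotient by \<open>A p n\<close> sends a
  coset \<open>C\<close> to the coset \<open>A p n <#> C\<close> that contains it.
\<close>

definition complete_filtration ::
  "(int \<Rightarrow> ('a, 'm) monoid_scheme) \<Rightarrow> (nat \<Rightarrow> int \<Rightarrow> 'a set) \<Rightarrow> bool"
  where "complete_filtration M A \<longleftrightarrow>
    (\<forall>n. (\<lambda>x p. A p n #>\<^bsub>M n\<^esub> x) \<in>
      iso (M n) (inverse_limit (\<lambda>p. M n Mod A p n) (\<lambda>p C. A p n <#>\<^bsub>M n\<^esub> C)))"

definition complete_filtered_complex ::
  "(int \<Rightarrow> ('a, 'm) monoid_scheme) \<Rightarrow> (nat \<Rightarrow> int \<Rightarrow> 'a set) \<Rightarrow> (int \<Rightarrow> 'a \<Rightarrow> 'a) \<Rightarrow> bool"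
  where "complete_filtered_complex M A d \<longleftrightarrow>
    chain_complex M d \<and> filtration M d A \<and> complete_filtration M A"

definition filtered_hom ::
  "int \<Rightarrow> (int \<Rightarrow> ('a, 'm) monoid_scheme) \<Rightarrow> (nat \<Rightarrow> int \<Rightarrow> 'a set)
     \<Rightarrow> (int \<Rightarrow> ('b, 'n) monoid_scheme) \<Rightarrow> (nat \<Rightarrow> int \<Rightarrow> 'b set) \<Rightarrow> (int \<Rightarrow> 'a \<Rightarrow> 'b) set"
  where "filtered_hom k M A N B =
    {f \<in> graded_hom k M N. \<forall>p n. f n ` A p n \<subseteq> B p (n + k)}"

definition chain_homotopy_equivalence ::
  "(int \<Rightarrow> ('a, 'm) monoid_scheme) \<Rightarrow> (nat \<Rightarrow> int \<Rightarrow> 'a set) \<Rightarrow> (int \<Rightarrow> 'a \<Rightarrow> 'a)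
     \<Rightarrow> (int \<Rightarrow> ('b, 'n) monoid_scheme) \<Rightarrow> (nat \<Rightarrow> int \<Rightarrow> 'b set) \<Rightarrow> (int \<Rightarrow> 'b \<Rightarrow> 'b)
     \<Rightarrow> (int \<Rightarrow> 'a \<Rightarrow> 'b) \<Rightarrow> (int \<Rightarrow> 'b \<Rightarrow> 'a) \<Rightarrow> (int \<Rightarrow> 'a \<Rightarrow> 'a) \<Rightarrow> (int \<Rightarrow> 'b \<Rightarrow> 'b) \<Rightarrow> bool"
  where "chain_homotopy_equivalence M A dM N B dN F G H L \<longleftrightarrow>
    F \<in> filtered_hom 0 M A N B \<and>
    G \<in> filtered_hom 0 N B M A \<and>
    H \<in> filtered_hom 1 M A M A \<and>
    L \<in> filtered_hom 1 N B N B \<and>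
    (\<forall>n. \<forall>x\<in>carrier (M n). F (n - 1) (dM n x) = dN n (F n x)) \<and>
    (\<forall>n. \<forall>y\<in>carrier (N n). G (n - 1) (dN n y) = dM n (G n y)) \<and>
    (\<forall>n. \<forall>x\<in>carrier (M n).
      G n (F n x) \<otimes>\<^bsub>M n\<^esub> inv\<^bsub>M n\<^esub> x = dM (n + 1) (H n x) \<otimes>\<^bsub>M n\<^esub> H (n - 1) (dM n x)) \<and>
    (\<forall>n. \<forall>y\<in>carrier (N n).
      F n (G n y) \<otimes>\<^bsub>N n\<^esub> inv\<^bsub>N n\<^esub> y = dN (n + 1) (L n y) \<otimes>\<^bsub>N n\<^esub> L (n - 1) (dN n y))"

definition perturbation ::
  "int \<Rightarrow> (int \<Rightarrow> ('a, 'm) monoid_scheme) \<Rightarrow> (nat \<Rightarrow> int \<Rightarrow> 'a set)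
     \<Rightarrow> (int \<Rightarrow> ('b, 'n) monoid_scheme) \<Rightarrow> (nat \<Rightarrow> int \<Rightarrow> 'b set)
     \<Rightarrow> (int \<Rightarrow> 'a \<Rightarrow> 'b) \<Rightarrow> (int \<Rightarrow> 'a \<Rightarrow> 'b) \<Rightarrow> bool"
  where "perturbation k M A N B f g \<longleftrightarrow>
    g \<in> graded_hom k M N \<and>
    (\<forall>p n. \<forall>x\<in>A p n. f n x \<otimes>\<^bsub>N (n + k)\<^esub> inv\<^bsub>N (n + k)\<^esub> g n x \<in> B (Suc p) (n + k))"

definition differential_perturbation ::
  "(int \<Rightarrow> ('a, 'm) monoid_scheme) \<Rightarrow> (nat \<Rightarrow> int \<Rightarrow> 'a set)
     \<Rightarrow> (int \<Rightarrow> 'a \<Rightarrow> 'a) \<Rightarrow> (int \<Rightarrow> 'a \<Rightarrow> 'a) \<Rightarrow> bool"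
  where "differential_perturbation M A d d' \<longleftrightarrow>
    perturbation (- 1) M A M A d d' \<and> square_zero M d'"

text \<open>The map \<open>L - F(GL - HG)\<close>, of degree \<open>1\<close> on \<open>N\<close>.\<close>

definition corrected_homotopy ::
  "(int \<Rightarrow> ('a, 'm) monoid_scheme) \<Rightarrow> (int \<Rightarrow> ('b, 'n) monoid_scheme)
     \<Rightarrow> (int \<Rightarrow> 'a \<Rightarrow> 'b) \<Rightarrow> (int \<Rightarrow> 'b \<Rightarrow> 'a) \<Rightarrow> (int \<Rightarrow> 'a \<Rightarrow> 'a) \<Rightarrow> (int \<Rightarrow> 'b \<Rightarrow> 'b)
     \<Rightarrow> int \<Rightarrow> 'b \<Rightarrow> 'b"
  where "corrected_homotopy M N F G H L = (\<lambda>n y.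
    L n y \<otimes>\<^bsub>N (n + 1)\<^esub> inv\<^bsub>N (n + 1)\<^esub>
      F (n + 1) (G (n + 1) (L n y) \<otimes>\<^bsub>M (n + 1)\<^esub> inv\<^bsub>M (n + 1)\<^esub> H n (G n y)))"

end

theory Submission
  imports Defs
begin

text \<open>
  Let \<open>r\<close> be the perturbation of \<open>d\<^sub>M\<close> and \<open>S = r + r H r + r H r H r + \<cdots>\<close>, which converges by
  completeness. Then \<open>d\<^sub>M S + S d\<^sub>M + S G F S = 0\<close>, and the usual formulas
  \<open>d\<^sub>N' = d\<^sub>N + F S G\<close>, \<open>F' = F + F S H\<close>, \<open>G' = G + H S G\<close>, \<open>H' = H + H S H\<close> work for every homotopy
  equivalence, except that \<open>F' G'\<close> still has to be contracted to the identity. This needs the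
  first few higher homotopies: if \<open>L0 = L - F (G L - H G)\<close>, there are maps \<open>a\<close>, \<open>b\<close>, \<open>c\<close> of degrees 2, 2, 3
  with \<open>G L0 - H G = d a - a d\<close>, \<open>F H - L0 F = d b - b d\<close> and \<open>a F + G b - H\<^sup>2 = d c + c d\<close>, and then
  \<open>L' = L0 + F S a + b S G + F S c S G\<close> is the required homotopy. All identities are verified in the
  endomorphism ring of the product of all \<open>M\<^sub>n \<times> N\<^sub>n\<close>.
\<close>

subsection \<open>Homotopy perturbation in a ring\<close>

text \<open>
  Both complexes live in one ring: \<open>d\<close> and \<open>e\<close> are the differentials of \<open>M\<close> and \<open>N\<close>, and \<open>p\<close>, \<open>q\<close>
  are the projections of \<open>M \<oplus> N\<close> onto \<open>M\<close> and \<open>N\<close>. Sums are kept free of subtractions where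
  possible because the simplifier does not cancel in a \<^locale>\<open>ring\<close>.
\<close>

locale homotopy_data = ring R for R (structure) +
  fixes p q d e F G H L
  assumes carr [simp, intro]: "p \<in> carrier R" "q \<in> carrier R" "d \<in> carrier R" "e \<in> carrier R"
      "F \<in> carrier R" "G \<in> carrier R" "H \<in> carrier R" "L \<in> carrier R"
    and unit_rules: "F \<otimes> p = F" "q \<otimes> F = F" "p \<otimes> G = G" "G \<otimes> q = G"
      "p \<otimes> H = H" "H \<otimes> p = H" "q \<otimes> L = L" "L \<otimes> q = L"
    and dF: "e \<otimes> F = F \<otimes> d" and Gd: "G \<otimes> e = d \<otimes> G"
    and GF: "G \<otimes> F = p \<oplus> (d \<otimes> H \<oplus> H \<otimes> d)"
    and FG: "F \<otimes> G = q \<oplus> (e \<otimes> L \<oplus> L \<otimes> e)"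
begin

text \<open>Products are normalised to right-nested form, where a rule for \<open>x y\<close> no
  longer matches \<open>x (y w)\<close>. This supplies the second version of each rule.\<close>

lemma assoc_rule:
  assumes "x \<otimes> y = z" "x \<in> carrier R" "y \<in> carrier R" "w \<in> carrier R"
  shows "x \<otimes> (y \<otimes> w) = z \<otimes> w"
  using assms m_assoc by metis

text \<open>Equations are proved after adding a suitable \<open>w\<close> to both sides:
  \<open>w\<close> absorbs the terms that would otherwise occur with a minus sign and completes
  partial sums to known ones.\<close>

lemma cancel_left:
  assumes "w \<oplus> x = w \<oplus> y" "w \<in> carrier R" "x \<in> carrier R" "y \<in> carrier R"
  shows "x = y"
  using assms by simp

lemmas expand = l_distr r_distr m_assoc a_ac
lemmas unit_assoc = unit_rules[THEN assoc_rule]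
lemmas dF_assoc = assoc_rule[OF dF] and Gd_assoc = assoc_rule[OF Gd]
  and GF_assoc = assoc_rule[OF GF]

lemmas chain_rules = unit_rules unit_assoc dF dF_assoc Gd Gd_assoc

text \<open>
  \<open>U\<close> is a cycle, the obstruction to \<open>G L \<simeq> H G\<close>. Replacing \<open>L\<close> by \<open>L0\<close> kills it: \<open>a\<close> and \<open>b\<close> are
  homotopies \<open>G L0 \<simeq> H G\<close> and \<open>L0 F \<simeq> F H\<close>. The same trick turns \<open>b0\<close> into \<open>b\<close>, which kills the
  cycle \<open>z\<close>, so that \<open>c\<close> is a homotopy \<open>a F + G b \<simeq> H\<^sup>2\<close>.
\<close>

definition "U = G \<otimes> L \<ominus> H \<otimes> G"
definition "L0 = L \<ominus> F \<otimes> U"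
definition "a = \<ominus> (H \<otimes> U)"
definition "b0 = (L \<otimes> (L \<otimes> F) \<oplus> F \<otimes> (H \<otimes> H)) \<ominus> L \<otimes> (F \<otimes> H)"
definition "z = (G \<otimes> b0 \<oplus> a \<otimes> F) \<ominus> H \<otimes> H"
definition "b = b0 \<ominus> F \<otimes> z"
definition "c = \<ominus> (H \<otimes> z)"

lemma carr2 [simp, intro]: "U \<in> carrier R" "L0 \<in> carrier R" "a \<in> carrier R" "b0 \<in> carrier R"
  "z \<in> carrier R" "b \<in> carrier R" "c \<in> carrier R"
  by (simp_all add: U_def L0_def a_def b0_def z_def b_def c_def)

lemma minus_add_cancel: "x \<in> carrier R \<Longrightarrow> y \<in> carrier R \<Longrightarrow> y \<oplus> (x \<ominus> y) = x"
  by (simp add: a_minus_def a_lcomm r_neg)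

text \<open>The definitions with all subtractions moved to the other side, so that they can be
  folded and unfolded inside plain sums.\<close>

lemma U_eq: "H \<otimes> G \<oplus> U = G \<otimes> L"
  and L0_eq: "F \<otimes> U \<oplus> L0 = L"
  and a_eq: "H \<otimes> U \<oplus> a = \<zero>"
  and b0_eq: "L \<otimes> (F \<otimes> H) \<oplus> b0 = L \<otimes> (L \<otimes> F) \<oplus> F \<otimes> (H \<otimes> H)"
  and z_eq: "H \<otimes> H \<oplus> z = G \<otimes> b0 \<oplus> a \<otimes> F"
  and b_eq: "F \<otimes> z \<oplus> b = b0"
  and c_eq: "H \<otimes> z \<oplus> c = \<zero>"
  by (simp_all add: U_def L0_def a_def b0_def z_def b_def c_def minus_add_cancel r_neg)

lemma U_rules: "p \<otimes> U = U" "U \<otimes> q = U"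
  by (simp_all add: U_def a_minus_def expand chain_rules r_minus l_minus)
lemma a_rules: "p \<otimes> a = a" "a \<otimes> q = a"
  by (simp_all add: a_def a_minus_def expand chain_rules r_minus l_minus U_rules)
lemma b0_rules: "q \<otimes> b0 = b0" "b0 \<otimes> p = b0"
  by (simp_all add: b0_def a_minus_def expand chain_rules r_minus l_minus U_rules)
lemma z_rules: "p \<otimes> z = z" "z \<otimes> p = z"
  by (simp_all add: z_def a_minus_def expand chain_rules r_minus l_minus b0_rules a_rules a_rules[THEN assoc_rule])

text \<open>Compute \<open>G F G\<close> in two ways: through \<open>F G\<close> it is
  \<open>G + d G L + G L e\<close>, through \<open>G F\<close> it is
  \<open>G + d H G + H G e\<close>.\<close>

lemma U_cycle: "d \<otimes> U \<oplus> U \<otimes> e = \<zero>"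
proof (rule cancel_left)
  let ?w = "d \<otimes> (H \<otimes> G) \<oplus> H \<otimes> (d \<otimes> G) \<oplus> G"
  have "?w \<oplus> (d \<otimes> U \<oplus> U \<otimes> e) = d \<otimes> (H \<otimes> G \<oplus> U) \<oplus> (H \<otimes> G \<oplus> U) \<otimes> e \<oplus> G"
    by (simp add: expand chain_rules)
  also have "\<dots> = G \<otimes> (F \<otimes> G)"
    unfolding U_eq FG by (simp add: expand chain_rules)
  also have "\<dots> = ?w"
    by (simp add: GF_assoc expand chain_rules)
  finally show "?w \<oplus> (d \<otimes> U \<oplus> U \<otimes> e) = ?w \<oplus> \<zero>" by simp
qed auto

text \<open>The correction satisfies \<open>e F U + F U e = F (d U + U e) = 0\<close>, so
  subtracting it from \<open>L\<close> does not disturb the homotopy equation.\<close>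

lemma L0_homotopy: "q \<oplus> (e \<otimes> L0 \<oplus> L0 \<otimes> e) = F \<otimes> G"
proof -
  have "F \<otimes> G = q \<oplus> (e \<otimes> (F \<otimes> U \<oplus> L0) \<oplus> (F \<otimes> U \<oplus> L0) \<otimes> e)"
    unfolding L0_eq FG ..
  also have "\<dots> = F \<otimes> (d \<otimes> U \<oplus> U \<otimes> e) \<oplus> (q \<oplus> (e \<otimes> L0 \<oplus> L0 \<otimes> e))"
    by (simp add: expand chain_rules)
  finally show ?thesis by (simp add: U_cycle)
qed

text \<open>Since \<open>G F\<close> is homotopic to the identity, the cycle \<open>U\<close> is
  homologous to \<open>G F U\<close>: one has
  \<open>G L0 - H G = U - G F U = -(d H U + H d U)\<close>, and
  \<open>H d U = -(H U e)\<close>.\<close>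

lemma a_homotopy: "G \<otimes> L0 \<oplus> a \<otimes> e = H \<otimes> G \<oplus> d \<otimes> a"
proof (rule cancel_left)
  let ?w = "U \<oplus> d \<otimes> (H \<otimes> U) \<oplus> H \<otimes> (d \<otimes> U) \<oplus> H \<otimes> (U \<otimes> e)"
  have "?w \<oplus> (G \<otimes> L0 \<oplus> a \<otimes> e) = G \<otimes> (F \<otimes> U) \<oplus> G \<otimes> L0 \<oplus> (H \<otimes> U \<oplus> a) \<otimes> e"
    by (simp add: GF_assoc expand chain_rules U_rules)
  also have "\<dots> = G \<otimes> (F \<otimes> U \<oplus> L0)"
    unfolding a_eq by (simp add: r_distr)
  also have "\<dots> = H \<otimes> G \<oplus> U \<oplus> d \<otimes> (H \<otimes> U \<oplus> a) \<oplus> H \<otimes> (d \<otimes> U \<oplus> U \<otimes> e)"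
    unfolding L0_eq a_eq U_cycle U_eq by simp
  also have "\<dots> = ?w \<oplus> (H \<otimes> G \<oplus> d \<otimes> a)"
    by (simp add: expand)
  finally show "?w \<oplus> (G \<otimes> L0 \<oplus> a \<otimes> e) = ?w \<oplus> (H \<otimes> G \<oplus> d \<otimes> a)" .
qed auto


text \<open>Compute \<open>F G F\<close> in two ways. Equivalently, \<open>L F - F H\<close> is a
  cycle.\<close>

lemma FH_homotopy: "e \<otimes> (L \<otimes> F) \<oplus> L \<otimes> (F \<otimes> d) = F \<otimes> (d \<otimes> H) \<oplus> F \<otimes> (H \<otimes> d)"
proof (rule cancel_left)
  have "F \<oplus> (e \<otimes> (L \<otimes> F) \<oplus> L \<otimes> (F \<otimes> d)) = (F \<otimes> G) \<otimes> F"
    unfolding FG by (simp add: expand chain_rules)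
  also have "\<dots> = F \<oplus> (F \<otimes> (d \<otimes> H) \<oplus> F \<otimes> (H \<otimes> d))"
    by (simp add: GF expand chain_rules)
  finally show "F \<oplus> (e \<otimes> (L \<otimes> F) \<oplus> L \<otimes> (F \<otimes> d)) = F \<oplus> (F \<otimes> (d \<otimes> H) \<oplus> F \<otimes> (H \<otimes> d))" .
qed auto

text \<open>Put \<open>V = L F - F H\<close>, a cycle by \<open>FH_homotopy\<close>, so that
  \<open>b0 = L V + F H H\<close>. Contracting \<open>V\<close> with \<open>L\<close> shows that
  \<open>(L V) d - e (L V) = V - F G V\<close>. Rewriting \<open>G L\<close> as
  \<open>H G + U\<close> gives \<open>F G V = F U F + F (H H d - d H H)\<close>, whose last part is
  cancelled by the summand \<open>F H H\<close> of \<open>b0\<close>.\<close>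

lemma b0_homotopy: "L0 \<otimes> F \<oplus> e \<otimes> b0 = F \<otimes> H \<oplus> b0 \<otimes> d"
proof (rule cancel_left)
  \<comment> \<open>\<open>F U F\<close> completes \<open>L0 F\<close> to \<open>L F\<close>, the
    terms \<open>e L F H\<close> and \<open>L F H d\<close> complete \<open>b0\<close> on either
    side, and \<open>F H G F\<close> joins \<open>F U F\<close> to form
    \<open>F G L F\<close>.\<close>
  let ?w = "F \<otimes> (U \<otimes> F) \<oplus> F \<otimes> (H \<otimes> (G \<otimes> F)) \<oplus> e \<otimes> (L \<otimes> (F \<otimes> H)) \<oplus> L \<otimes> (F \<otimes> (H \<otimes> d))"
  have "?w \<oplus> (L0 \<otimes> F \<oplus> e \<otimes> b0)
      = (F \<otimes> U \<oplus> L0) \<otimes> F \<oplus> F \<otimes> (H \<otimes> (G \<otimes> F)) \<oplus> e \<otimes> (L \<otimes> (F \<otimes> H) \<oplus> b0) \<oplus> L \<otimes> (F \<otimes> (H \<otimes> d))"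
    by (simp add: expand)
  also have "\<dots> = F \<otimes> H \<oplus> F \<otimes> (H \<otimes> (H \<otimes> d)) \<oplus> L \<otimes> F \<oplus> e \<otimes> (L \<otimes> (L \<otimes> F))
      \<oplus> L \<otimes> (F \<otimes> (H \<otimes> d)) \<oplus> (e \<otimes> (L \<otimes> F) \<oplus> L \<otimes> (F \<otimes> d)) \<otimes> H"
    unfolding L0_eq b0_eq FH_homotopy by (simp add: GF expand chain_rules)
  also have "\<dots> = F \<otimes> H \<oplus> F \<otimes> (H \<otimes> (H \<otimes> d)) \<oplus> L \<otimes> F \<oplus> e \<otimes> (L \<otimes> (L \<otimes> F))
      \<oplus> e \<otimes> (L \<otimes> (F \<otimes> H)) \<oplus> L \<otimes> (F \<otimes> (d \<otimes> H) \<oplus> F \<otimes> (H \<otimes> d))"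
    by (simp add: expand)
  also have "\<dots> = F \<otimes> H \<oplus> (L \<otimes> (L \<otimes> F) \<oplus> F \<otimes> (H \<otimes> H)) \<otimes> d
      \<oplus> (q \<oplus> (e \<otimes> L \<oplus> L \<otimes> e)) \<otimes> (L \<otimes> F) \<oplus> e \<otimes> (L \<otimes> (F \<otimes> H))"
    unfolding FH_homotopy[symmetric] by (simp add: expand chain_rules)
  also have "\<dots> = F \<otimes> H \<oplus> (L \<otimes> (F \<otimes> H) \<oplus> b0) \<otimes> d \<oplus> F \<otimes> ((G \<otimes> L) \<otimes> F) \<oplus> e \<otimes> (L \<otimes> (F \<otimes> H))"
    unfolding FG[symmetric] b0_eq by (simp add: m_assoc)
  also have "\<dots> = ?w \<oplus> (F \<otimes> H \<oplus> b0 \<otimes> d)"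
    unfolding U_eq[symmetric] by (simp add: expand)
  finally show "?w \<oplus> (L0 \<otimes> F \<oplus> e \<otimes> b0) = ?w \<oplus> (F \<otimes> H \<oplus> b0 \<otimes> d)" .
qed auto

text \<open>Compute \<open>G L0 F\<close> both from \<open>G\<close> times
  \<open>b0_homotopy\<close> and from \<open>a_homotopy\<close> times \<open>F\<close>. The two
  results differ by \<open>G F H - H G F = d H H - H H d\<close>, which accounts for the summand
  \<open>H H\<close> in \<open>z\<close>.\<close>

lemma z_cycle: "d \<otimes> z = z \<otimes> d"
proof (rule cancel_left)
  let ?w = "G \<otimes> (L0 \<otimes> F) \<oplus> d \<otimes> (H \<otimes> H) \<oplus> H \<otimes> (G \<otimes> F) \<oplus> a \<otimes> (F \<otimes> d)"
  have "?w \<oplus> d \<otimes> z = G \<otimes> (L0 \<otimes> F) \<oplus> d \<otimes> (H \<otimes> H \<oplus> z) \<oplus> H \<otimes> (G \<otimes> F) \<oplus> a \<otimes> (F \<otimes> d)"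
    by (simp add: expand)
  also have "\<dots> = G \<otimes> (L0 \<otimes> F \<oplus> e \<otimes> b0) \<oplus> (H \<otimes> G \<oplus> d \<otimes> a) \<otimes> F \<oplus> a \<otimes> (F \<otimes> d)"
    unfolding z_eq by (simp add: expand chain_rules)
  also have "\<dots> = G \<otimes> (F \<otimes> H) \<oplus> (G \<otimes> b0 \<oplus> a \<otimes> F) \<otimes> d \<oplus> G \<otimes> (L0 \<otimes> F) \<oplus> a \<otimes> (F \<otimes> d)"
    unfolding b0_homotopy a_homotopy[symmetric] by (simp add: expand chain_rules)
  also have "\<dots> = ?w \<oplus> z \<otimes> d"
    unfolding z_eq[symmetric] by (simp add: GF GF_assoc expand chain_rules)
  finally show "?w \<oplus> d \<otimes> z = ?w \<oplus> z \<otimes> d" .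
qed auto

text \<open>\<open>F z\<close> commutes with the differentials because \<open>z\<close> and
  \<open>F\<close> do, so \<open>b\<close> bounds the same difference as \<open>b0\<close>.\<close>

lemma b_homotopy: "L0 \<otimes> F \<oplus> e \<otimes> b = F \<otimes> H \<oplus> b \<otimes> d"
proof (rule cancel_left)
  have "F \<otimes> (d \<otimes> z) \<oplus> (L0 \<otimes> F \<oplus> e \<otimes> b) = L0 \<otimes> F \<oplus> e \<otimes> (F \<otimes> z \<oplus> b)"
    by (simp add: expand chain_rules)
  also have "\<dots> = F \<otimes> H \<oplus> (F \<otimes> z \<oplus> b) \<otimes> d"
    unfolding b_eq by (rule b0_homotopy)
  also have "\<dots> = F \<otimes> (d \<otimes> z) \<oplus> (F \<otimes> H \<oplus> b \<otimes> d)"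
    by (simp add: expand z_cycle)
  finally show "F \<otimes> (d \<otimes> z) \<oplus> (L0 \<otimes> F \<oplus> e \<otimes> b) = F \<otimes> (d \<otimes> z) \<oplus> (F \<otimes> H \<oplus> b \<otimes> d)" .
qed auto

text \<open>As for \<open>a\<close>: the left side minus \<open>H H\<close> is
  \<open>z - G F z = -(d H z + H d z)\<close>, and \<open>z\<close> commutes with
  \<open>d\<close>.\<close>

lemma c_homotopy: "a \<otimes> F \<oplus> G \<otimes> b = H \<otimes> H \<oplus> (d \<otimes> c \<oplus> c \<otimes> d)"
proof (rule cancel_left)
  let ?w = "G \<otimes> (F \<otimes> z)"
  have "?w \<oplus> (a \<otimes> F \<oplus> G \<otimes> b) = a \<otimes> F \<oplus> G \<otimes> (F \<otimes> z \<oplus> b)"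
    by (simp add: expand)
  also have "\<dots> = H \<otimes> H \<oplus> z \<oplus> d \<otimes> (H \<otimes> z \<oplus> c) \<oplus> (H \<otimes> z \<oplus> c) \<otimes> d"
    unfolding b_eq c_eq z_eq by (simp add: a_ac)
  also have "\<dots> = ?w \<oplus> (H \<otimes> H \<oplus> (d \<otimes> c \<oplus> c \<otimes> d))"
    by (simp add: GF_assoc expand chain_rules z_rules z_cycle)
  finally show "?w \<oplus> (a \<otimes> F \<oplus> G \<otimes> b) = ?w \<oplus> (H \<otimes> H \<oplus> (d \<otimes> c \<oplus> c \<otimes> d))" .
qed auto

end

section \<open>The perturbed differential, maps and homotopies\<close>

locale perturbed_homotopy_data = homotopy_data +
  fixes r S
  assumes carr_rS [simp, intro]: "r \<in> carrier R" "S \<in> carrier R"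
    and unit_S: "p \<otimes> S = S" "S \<otimes> p = S"
    and r_eq: "d \<otimes> r \<oplus> (r \<otimes> d \<oplus> r \<otimes> r) = \<zero>"
    and S_left: "S = r \<oplus> r \<otimes> (H \<otimes> S)"
    and S_right: "S = r \<oplus> S \<otimes> (H \<otimes> r)"
begin

lemmas S_rules = unit_S unit_S[THEN assoc_rule]

text \<open>
  Formally \<open>S = r (1 - H r)\<^sup>-\<^sup>1\<close>, and the equation is
  \<open>(1 - r H)\<^sup>-\<^sup>1 (d r + r d + r\<^sup>2) (1 - H r)\<^sup>-\<^sup>1 = 0\<close>.
\<close>

lemma S_square: "d \<otimes> S \<oplus> S \<otimes> d \<oplus> S \<otimes> (G \<otimes> (F \<otimes> S)) = \<zero>"
proof -
  \<comment> \<open>\<open>1 + S H\<close> and \<open>1 + H S\<close> are the inverses of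
    \<open>1 - r H\<close> and \<open>1 - H r\<close>.\<close>
  have eq: "(\<one> \<oplus> S \<otimes> H) \<otimes> r = S" "r \<otimes> (\<one> \<oplus> H \<otimes> S) = S"
    using S_left S_right by (simp_all add: expand)
  have "\<zero> = (\<one> \<oplus> S \<otimes> H) \<otimes> (d \<otimes> r \<oplus> (r \<otimes> d \<oplus> r \<otimes> r)) \<otimes> (\<one> \<oplus> H \<otimes> S)"
    by (simp add: r_eq)
  also have "\<dots> = (\<one> \<oplus> S \<otimes> H) \<otimes> d \<otimes> (r \<otimes> (\<one> \<oplus> H \<otimes> S))
      \<oplus> (((\<one> \<oplus> S \<otimes> H) \<otimes> r) \<otimes> d \<otimes> (\<one> \<oplus> H \<otimes> S)
      \<oplus> ((\<one> \<oplus> S \<otimes> H) \<otimes> r) \<otimes> (r \<otimes> (\<one> \<oplus> H \<otimes> S)))"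
    by (simp add: expand)
  also have "\<dots> = d \<otimes> S \<oplus> S \<otimes> d \<oplus> S \<otimes> (G \<otimes> (F \<otimes> S))"
    unfolding eq by (simp add: GF_assoc expand S_rules)
  finally show ?thesis ..
qed

text \<open>\<open>S_square\<close> with factors on both sides, in the expanded and bracketed form
  in which it occurs as a block of the larger sums below.\<close>

lemma S_square_between:
  assumes "x \<in> carrier R" "y \<in> carrier R"
  shows "x \<otimes> (d \<otimes> (S \<otimes> y)) \<oplus> (x \<otimes> (S \<otimes> (d \<otimes> y)) \<oplus> x \<otimes> (S \<otimes> (G \<otimes> (F \<otimes> (S \<otimes> y))))) = \<zero>"
proof -
  have "x \<otimes> (d \<otimes> S \<oplus> S \<otimes> d \<oplus> S \<otimes> (G \<otimes> (F \<otimes> S))) \<otimes> y = \<zero>"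
    using assms by (simp add: S_square)
  then show ?thesis
    using assms by (simp add: expand)
qed

definition "e' = e \<oplus> F \<otimes> (S \<otimes> G)"
definition "F' = F \<oplus> F \<otimes> (S \<otimes> H)"
definition "G' = G \<oplus> H \<otimes> (S \<otimes> G)"
definition "H' = H \<oplus> H \<otimes> (S \<otimes> H)"
definition "L' = L0 \<oplus> (F \<otimes> (S \<otimes> a) \<oplus> b \<otimes> (S \<otimes> G) \<oplus> F \<otimes> (S \<otimes> (c \<otimes> (S \<otimes> G))))"

text \<open>Apart from \<open>e e\<close>, the square is
  \<open>F (d S + S d + S G F S) G\<close>.\<close>

lemma e'_square:
  assumes "e \<otimes> e = \<zero>"
  shows "e' \<otimes> e' = \<zero>"
proof -
  have "e' \<otimes> e' = e \<otimes> e \<oplus> (F \<otimes> (d \<otimes> (S \<otimes> G)) \<oplus> (F \<otimes> (S \<otimes> (d \<otimes> G)) \<oplus> F \<otimes> (S \<otimes> (G \<otimes> (F \<otimes> (S \<otimes> G))))))"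
    unfolding e'_def by (simp add: expand chain_rules)
  then show ?thesis
    using assms by (simp add: S_square_between)
qed

text \<open>Both sides equal \<open>F d + F S + F S H d\<close>: the left one by
  \<open>S_right\<close>, the right one by \<open>S_square\<close> and the formula for
  \<open>G F\<close>.\<close>

lemma F'_chain: "F' \<otimes> (d \<oplus> r) = e' \<otimes> F'"
proof (rule cancel_left)
  let ?w = "F \<otimes> (S \<otimes> (d \<otimes> H))"
  have "?w \<oplus> F' \<otimes> (d \<oplus> r) = ?w \<oplus> F \<otimes> d \<oplus> F \<otimes> (S \<otimes> (H \<otimes> d)) \<oplus> F \<otimes> (r \<oplus> S \<otimes> (H \<otimes> r))"
    unfolding F'_def by (simp add: expand)
  also have "\<dots> = F \<otimes> d \<oplus> F \<otimes> (S \<otimes> (G \<otimes> F))"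
    unfolding S_right[symmetric] by (simp add: GF expand S_rules)
  also have "\<dots> = F \<otimes> d \<oplus> F \<otimes> (S \<otimes> (G \<otimes> F)) \<oplus> (F \<otimes> (d \<otimes> (S \<otimes> H)) \<oplus> (F \<otimes> (S \<otimes> (d \<otimes> H)) \<oplus> F \<otimes> (S \<otimes> (G \<otimes> (F \<otimes> (S \<otimes> H))))))"
    by (simp add: S_square_between)
  also have "\<dots> = ?w \<oplus> e' \<otimes> F'"
    unfolding F'_def e'_def by (simp add: expand chain_rules)
  finally show "?w \<oplus> F' \<otimes> (d \<oplus> r) = ?w \<oplus> e' \<otimes> F'" .
qed (auto simp: F'_def e'_def)

text \<open>The mirror image of \<open>F'_chain\<close>, with \<open>S_left\<close> in place of
  \<open>S_right\<close>.\<close>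

lemma G'_chain: "G' \<otimes> e' = (d \<oplus> r) \<otimes> G'"
proof (rule cancel_left)
  let ?w = "H \<otimes> (d \<otimes> (S \<otimes> G))"
  have "?w \<oplus> G' \<otimes> e' = d \<otimes> G \<oplus> G \<otimes> (F \<otimes> (S \<otimes> G)) \<oplus> (H \<otimes> (d \<otimes> (S \<otimes> G)) \<oplus> (H \<otimes> (S \<otimes> (d \<otimes> G)) \<oplus> H \<otimes> (S \<otimes> (G \<otimes> (F \<otimes> (S \<otimes> G))))))"
    unfolding G'_def e'_def by (simp add: expand chain_rules)
  also have "\<dots> = d \<otimes> G \<oplus> G \<otimes> (F \<otimes> (S \<otimes> G))"
    by (simp add: S_square_between)
  also have "\<dots> = ?w \<oplus> d \<otimes> G \<oplus> d \<otimes> (H \<otimes> (S \<otimes> G)) \<oplus> S \<otimes> G"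
    by (simp add: GF_assoc expand S_rules)
  also have "\<dots> = ?w \<oplus> d \<otimes> G \<oplus> d \<otimes> (H \<otimes> (S \<otimes> G)) \<oplus> (r \<oplus> r \<otimes> (H \<otimes> S)) \<otimes> G"
    unfolding S_left[symmetric] ..
  also have "\<dots> = ?w \<oplus> (d \<oplus> r) \<otimes> G'"
    unfolding G'_def by (simp add: expand)
  finally show "?w \<oplus> G' \<otimes> e' = ?w \<oplus> (d \<oplus> r) \<otimes> G'" .
qed (auto simp: G'_def e'_def)

text \<open>\<open>S_square\<close> removes the term of \<open>G' F'\<close> that is quadratic in
  \<open>S\<close>. What remains contains \<open>S H + H S\<close>; splitting \<open>S\<close> by
  \<open>S_left\<close> in the first and by \<open>S_right\<close> in the second produces exactly
  the terms with \<open>r\<close>.\<close>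

lemma H'_homotopy: "G' \<otimes> F' = p \<oplus> ((d \<oplus> r) \<otimes> H' \<oplus> H' \<otimes> (d \<oplus> r))"
proof (rule cancel_left)
  let ?w = "H \<otimes> (d \<otimes> (S \<otimes> H)) \<oplus> H \<otimes> (S \<otimes> (d \<otimes> H))"
  have "?w \<oplus> G' \<otimes> F' = G \<otimes> F \<oplus> H \<otimes> (S \<otimes> (G \<otimes> F)) \<oplus> G \<otimes> (F \<otimes> (S \<otimes> H)) \<oplus> (H \<otimes> (d \<otimes> (S \<otimes> H)) \<oplus> (H \<otimes> (S \<otimes> (d \<otimes> H)) \<oplus> H \<otimes> (S \<otimes> (G \<otimes> (F \<otimes> (S \<otimes> H))))))"
    unfolding G'_def F'_def by (simp add: expand)
  also have "\<dots> = G \<otimes> F \<oplus> H \<otimes> (S \<otimes> (G \<otimes> F)) \<oplus> G \<otimes> (F \<otimes> (S \<otimes> H))"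
    by (simp add: S_square_between)
  also have "\<dots> = ?w \<oplus> p \<oplus> d \<otimes> H \<oplus> H \<otimes> d \<oplus> d \<otimes> (H \<otimes> (S \<otimes> H)) \<oplus> H \<otimes> (S \<otimes> (H \<otimes> d)) \<oplus> S \<otimes> H \<oplus> H \<otimes> S"
    by (simp add: GF GF_assoc expand S_rules)
  also have "\<dots> = ?w \<oplus> p \<oplus> d \<otimes> H \<oplus> H \<otimes> d \<oplus> d \<otimes> (H \<otimes> (S \<otimes> H)) \<oplus> H \<otimes> (S \<otimes> (H \<otimes> d))
      \<oplus> (r \<oplus> r \<otimes> (H \<otimes> S)) \<otimes> H \<oplus> H \<otimes> (r \<oplus> S \<otimes> (H \<otimes> r))"
    unfolding S_left[symmetric] S_right[symmetric] ..
  also have "\<dots> = ?w \<oplus> (p \<oplus> ((d \<oplus> r) \<otimes> H' \<oplus> H' \<otimes> (d \<oplus> r)))"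
    unfolding H'_def by (simp add: expand)
  finally show "?w \<oplus> G' \<otimes> F' = ?w \<oplus> (p \<oplus> ((d \<oplus> r) \<otimes> H' \<oplus> H' \<otimes> (d \<oplus> r)))" .
qed (auto simp: G'_def F'_def H'_def)

text \<open>Expand \<open>F' G'\<close> into \<open>F G\<close>, \<open>F S H G\<close>,
  \<open>F H S G\<close> and \<open>F S H H S G\<close>. The homotopies \<open>L0\<close>,
  \<open>a\<close>, \<open>b\<close> and \<open>c\<close> respectively replace \<open>F G\<close>,
  \<open>H G\<close>, \<open>F H\<close> and \<open>H H\<close>; their boundary terms form
  \<open>w\<close>.\<close>

lemma L'_homotopy: "F' \<otimes> G' = q \<oplus> (e' \<otimes> L' \<oplus> L' \<otimes> e')"
proof (rule cancel_left)
  let ?w = "F \<otimes> (S \<otimes> (d \<otimes> a)) \<oplus> b \<otimes> (d \<otimes> (S \<otimes> G)) \<oplus> F \<otimes> (S \<otimes> ((d \<otimes> c \<oplus> c \<otimes> d) \<otimes> (S \<otimes> G)))"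
  \<comment> \<open>The first four groups are the left sides of the homotopy equations. The last
    four vanish by \<open>S_square\<close>, placed between \<open>F\<close> and \<open>a\<close>,
    \<open>b\<close> and \<open>G\<close>, \<open>F\<close> and \<open>c S G\<close>, and
    \<open>F S c\<close> and \<open>G\<close>.\<close>
  have "?w \<oplus> (q \<oplus> (e' \<otimes> L' \<oplus> L' \<otimes> e'))
    = (q \<oplus> (e \<otimes> L0 \<oplus> L0 \<otimes> e)) \<oplus> F \<otimes> (S \<otimes> (G \<otimes> L0 \<oplus> a \<otimes> e))
      \<oplus> (L0 \<otimes> F \<oplus> e \<otimes> b) \<otimes> (S \<otimes> G) \<oplus> F \<otimes> (S \<otimes> ((a \<otimes> F \<oplus> G \<otimes> b) \<otimes> (S \<otimes> G)))
      \<oplus> (F \<otimes> (d \<otimes> (S \<otimes> a)) \<oplus> (F \<otimes> (S \<otimes> (d \<otimes> a)) \<oplus> F \<otimes> (S \<otimes> (G \<otimes> (F \<otimes> (S \<otimes> a))))))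
      \<oplus> (b \<otimes> (d \<otimes> (S \<otimes> G)) \<oplus> (b \<otimes> (S \<otimes> (d \<otimes> G)) \<oplus> b \<otimes> (S \<otimes> (G \<otimes> (F \<otimes> (S \<otimes> G))))))
      \<oplus> (F \<otimes> (d \<otimes> (S \<otimes> (c \<otimes> (S \<otimes> G)))) \<oplus> (F \<otimes> (S \<otimes> (d \<otimes> (c \<otimes> (S \<otimes> G)))) \<oplus> F \<otimes> (S \<otimes> (G \<otimes> (F \<otimes> (S \<otimes> (c \<otimes> (S \<otimes> G))))))))
      \<oplus> ((F \<otimes> (S \<otimes> c)) \<otimes> (d \<otimes> (S \<otimes> G)) \<oplus> ((F \<otimes> (S \<otimes> c)) \<otimes> (S \<otimes> (d \<otimes> G)) \<oplus> (F \<otimes> (S \<otimes> c)) \<otimes> (S \<otimes> (G \<otimes> (F \<otimes> (S \<otimes> G))))))"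
    unfolding e'_def L'_def by (simp add: expand chain_rules)
  also have "\<dots> = F \<otimes> G \<oplus> F \<otimes> (S \<otimes> (H \<otimes> G \<oplus> d \<otimes> a))
      \<oplus> (F \<otimes> H \<oplus> b \<otimes> d) \<otimes> (S \<otimes> G) \<oplus> F \<otimes> (S \<otimes> ((H \<otimes> H \<oplus> (d \<otimes> c \<oplus> c \<otimes> d)) \<otimes> (S \<otimes> G)))"
    unfolding L0_homotopy a_homotopy b_homotopy c_homotopy by (simp add: S_square_between)
  also have "\<dots> = ?w \<oplus> F' \<otimes> G'"
    unfolding F'_def G'_def by (simp add: expand)
  finally show "?w \<oplus> F' \<otimes> G' = ?w \<oplus> (q \<oplus> (e' \<otimes> L' \<oplus> L' \<otimes> e'))" ..
qed (auto simp: G'_def F'_def L'_def e'_def)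

end

subsection \<open>Geometric series in complete filtered groups\<close>

locale complete_filtered_group = comm_group G for G (structure) +
  fixes A :: "nat \<Rightarrow> 'a set"
  assumes subgroup_A: "subgroup (A p) G"
    and A_0: "A 0 = carrier G"
    and A_Suc: "A (Suc p) \<subseteq> A p"
    and complete: "(\<lambda>x p. A p #> x) \<in> iso G (inverse_limit (\<lambda>p. G Mod A p) (\<lambda>p C. A p <#> C))"
begin

lemma A_carrier: "x \<in> A p \<Longrightarrow> x \<in> carrier G"
  using subgroup.mem_carrier[OF subgroup_A] .

text \<open>This is the injectivity half of completeness; \<open>limit_exists\<close> below is the
  surjectivity half.\<close>

lemma separated:
  assumes "\<And>p. x \<in> A p"
  shows "x = \<one>"
proof -
  have "(\<lambda>p. A p #> x) = (\<lambda>p. A p #> \<one>)"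
    using assms coset_join2[OF _ subgroup_A] A_carrier by (metis coset_mult_one subgroup_A subgroup.subset)
  moreover have "inj_on (\<lambda>x p. A p #> x) (carrier G)"
    using complete by (simp add: iso_def bij_betw_def)
  ultimately show ?thesis
    using assms A_carrier by (meson inj_onD one_closed)
qed

lemma eq_if_close:
  assumes "x \<in> carrier G" "y \<in> carrier G" "\<And>p. x \<otimes> inv y \<in> A p"
  shows "x = y"
proof -
  have "x \<otimes> inv y = \<one>" using assms(3) by (rule separated)
  then show ?thesis using assms(1,2) by (metis inv_equality inv_inv inv_closed)
qed

lemma rcos_eq:
  assumes "x \<in> carrier G" "y \<in> carrier G" "x \<otimes> inv y \<in> A p"
  shows "A p #> x = A p #> y"
proof -
  have "A p #> x = A p #> ((x \<otimes> inv y) \<otimes> y)" using assms by (simp add: m_assoc)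
  also have "\<dots> = (A p #> (x \<otimes> inv y)) #> y"
    using assms subgroup.subset[OF subgroup_A] by (simp add: coset_mult_assoc)
  also have "\<dots> = A p #> y"
    using assms by (simp add: coset_join2 subgroup_A)
  finally show ?thesis .
qed

lemma limit_exists:
  assumes s: "\<And>p. s p \<in> carrier G" and Cauchy: "\<And>p. s (Suc p) \<otimes> inv s p \<in> A p"
  obtains x where "x \<in> carrier G" "\<And>p. x \<otimes> inv s p \<in> A p"
proof -
  \<comment> \<open>The cosets of the \<open>s p\<close> are compatible under the transition maps,
    hence define a point of the inverse limit.\<close>
  have "A p <#> (A (Suc p) #> s (Suc p)) = A p #> s p" for p
  proof -
    have "A p <#> A (Suc p) = A p"
      by (rule set_mult_subgroup_idem[OF subgroup_A]) (metis subgroup_incl subgroup_A A_Suc)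
    then have "A p <#> (A (Suc p) #> s (Suc p)) = A p #> s (Suc p)"
      using s subgroup.subset[OF subgroup_A] by (simp add: setmult_rcos_assoc)
    also have "\<dots> = A p #> s p" using s Cauchy by (intro rcos_eq)
    finally show ?thesis .
  qed
  moreover have "A p #> s p \<in> carrier (G Mod A p)" for p
    using s subgroup.subset[OF subgroup_A] by (auto simp: FactGroup_def RCOSETS_def)
  ultimately have "(\<lambda>p. A p #> s p) \<in> carrier (inverse_limit (\<lambda>p. G Mod A p) (\<lambda>p C. A p <#> C))"
    by (auto simp: inverse_limit_def)
  then obtain x where x: "x \<in> carrier G" and eq: "(\<lambda>p. A p #> s p) = (\<lambda>p. A p #> x)"
    using complete by (auto simp: iso_def bij_betw_def)
  have "x \<otimes> inv s p \<in> A p" for p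
  proof -
    have "x \<in> A p #> s p"
      using fun_cong[OF eq, of p] x subgroup_A by (metis rcos_self)
    then show ?thesis
      using s A_carrier by (auto simp: r_coset_def m_assoc)
  qed
  with x show thesis by (rule that)
qed

lemma mult_inv_mult_cancel:
  assumes "x \<in> carrier G" "y \<in> carrier G" "z \<in> carrier G"
  shows "(x \<otimes> y) \<otimes> inv (x \<otimes> z) = y \<otimes> inv z"
proof -
  have "(x \<otimes> y) \<otimes> inv (x \<otimes> z) = y \<otimes> (x \<otimes> (inv x \<otimes> inv z))"
    using assms by (simp add: inv_mult m_assoc m_lcomm)
  also have "x \<otimes> (inv x \<otimes> inv z) = inv z"
    using assms by (simp flip: m_assoc)
  finally show ?thesis .
qed

text \<open>The difference of two solutions is fixed by \<open>\<phi>\<close>, so it lies in every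
  \<open>A p\<close>.\<close>

lemma fixed_point_unique:
  assumes \<phi>: "\<phi> \<in> hom G G" "\<And>p x. x \<in> A p \<Longrightarrow> \<phi> x \<in> A (Suc p)"
    and "x \<in> carrier G" "y \<in> carrier G" "y' \<in> carrier G" "y = x \<otimes> \<phi> y" "y' = x \<otimes> \<phi> y'"
  shows "y = y'"
proof (rule eq_if_close)
  interpret group_hom G G \<phi> using \<phi>(1) by unfold_locales
  have "y \<otimes> inv y' = (x \<otimes> \<phi> y) \<otimes> inv (x \<otimes> \<phi> y')" using assms(6,7) by simp
  also have "\<dots> = \<phi> (y \<otimes> inv y')"
    using assms(3-5) by (simp add: mult_inv_mult_cancel)
  finally have eq: "y \<otimes> inv y' = \<phi> (y \<otimes> inv y')" .
  show "y \<otimes> inv y' \<in> A p" for p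
  proof (induction p)
    case 0
    then show ?case using assms(4,5) by (simp add: A_0)
  next
    case (Suc p)
    then show ?case using \<phi>(2) eq by metis
  qed
qed (use assms in auto)

text \<open>Iterate \<open>y \<mapsto> x \<otimes> \<phi> y\<close> from \<open>x\<close>; each
  application of \<open>\<phi>\<close> improves the accuracy by one filtration step, so the iterates
  converge.\<close>

lemma fixed_point_exists:
  assumes \<phi>: "\<phi> \<in> hom G G" "\<And>p x. x \<in> A p \<Longrightarrow> \<phi> x \<in> A (Suc p)"
    and x: "x \<in> carrier G"
  shows "\<exists>y\<in>carrier G. y = x \<otimes> \<phi> y \<and> (\<forall>p. x \<in> A p \<longrightarrow> y \<in> A p)"
proof -
  interpret group_hom G G \<phi> using \<phi>(1) by unfold_locales
  define s where "s = rec_nat x (\<lambda>_ y. x \<otimes> \<phi> y)"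
  have s_0: "s 0 = x" and s_Suc: "\<And>p. s (Suc p) = x \<otimes> \<phi> (s p)" by (simp_all add: s_def)
  have s: "s p \<in> carrier G" for p by (induction p) (use x in \<open>simp_all add: s_0 s_Suc\<close>)
  have diff: "(x \<otimes> \<phi> y) \<otimes> inv (x \<otimes> \<phi> z) = \<phi> (y \<otimes> inv z)" if "y \<in> carrier G" "z \<in> carrier G" for y z
    using x that by (simp add: mult_inv_mult_cancel)
  have "s (Suc p) \<otimes> inv s p \<in> A p" for p
  proof (induction p)
    case 0
    then show ?case using s by (simp add: A_0)
  next
    case (Suc p)
    have "s (Suc (Suc p)) \<otimes> inv s (Suc p) = \<phi> (s (Suc p) \<otimes> inv s p)"
      using s diff by (metis s_Suc)
    with Suc show ?case by (simp add: \<phi>(2))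
  qed
  then obtain y where y: "y \<in> carrier G" and lim: "\<And>p. y \<otimes> inv s p \<in> A p"
    using s limit_exists by blast
  have "y = x \<otimes> \<phi> y"
  proof (rule eq_if_close)
    fix p
    \<comment> \<open>Both \<open>y\<close> and \<open>x \<otimes> \<phi> y\<close> are congruent to
      \<open>s (Suc p)\<close> modulo \<open>A (Suc p)\<close>.\<close>
    have "inv (\<phi> (y \<otimes> inv s p)) \<in> A (Suc p)"
      using \<phi>(2) lim subgroup.m_inv_closed[OF subgroup_A] by blast
    then have "(y \<otimes> inv s (Suc p)) \<otimes> inv (\<phi> (y \<otimes> inv s p)) \<in> A (Suc p)"
      using lim subgroup.m_closed[OF subgroup_A] by blast
    also have "(y \<otimes> inv s (Suc p)) \<otimes> inv (\<phi> (y \<otimes> inv s p)) = y \<otimes> inv (x \<otimes> \<phi> y)"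
      unfolding s_Suc diff[OF y s, symmetric]
      using mult_inv_mult_cancel[of "inv (x \<otimes> \<phi> (s p))" y "x \<otimes> \<phi> y"] y x s
      by (simp add: m_comm[of "inv (x \<otimes> \<phi> (s p))"] del: inv_mult)
    finally show "y \<otimes> inv (x \<otimes> \<phi> y) \<in> A p" using A_Suc by blast
  qed (use x y in auto)
  moreover have "y \<in> A p" if xA: "x \<in> A p" for p
  proof -
    have "s i \<in> A p" for i
    proof (induction i)
      case (Suc i)
      then have "\<phi> (s i) \<in> A p" using \<phi>(2) A_Suc by blast
      with xA show ?case using subgroup.m_closed[OF subgroup_A] by (simp add: s_Suc)
    qed (use xA s_0 in simp)
    then have "(y \<otimes> inv s p) \<otimes> s p \<in> A p" using lim subgroup.m_closed[OF subgroup_A] by blast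
    then show ?thesis using y s by (simp add: m_assoc)
  qed
  ultimately show ?thesis using y by blast
qed

text \<open>\<open>T\<close> is the sum of all powers of \<open>\<phi>\<close>, chosen pointwise as
  a fixed point. Additivity and the second recursion follow from uniqueness of fixed points.\<close>

lemma geometric_series:
  assumes \<phi>: "\<phi> \<in> hom G G" "\<And>p x. x \<in> A p \<Longrightarrow> \<phi> x \<in> A (Suc p)"
  shows "\<exists>T\<in>hom G G. (\<forall>p. T ` A p \<subseteq> A p) \<and>
    (\<forall>x\<in>carrier G. T x = x \<otimes> \<phi> (T x)) \<and> (\<forall>x\<in>carrier G. T x = x \<otimes> T (\<phi> x))"
proof -
  interpret group_hom G G \<phi> using \<phi>(1) by unfold_locales
  obtain T where T: "\<And>x. x \<in> carrier G \<Longrightarrow> T x \<in> carrier G"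
    "\<And>x. x \<in> carrier G \<Longrightarrow> T x = x \<otimes> \<phi> (T x)"
    "\<And>x p. x \<in> carrier G \<Longrightarrow> x \<in> A p \<Longrightarrow> T x \<in> A p"
    using fixed_point_exists[OF \<phi>] by metis
  have eqI: "T x = y" if "x \<in> carrier G" "y \<in> carrier G" "y = x \<otimes> \<phi> y" for x y
    using fixed_point_unique[OF \<phi>] T that by blast
  have "T (x \<otimes> y) = T x \<otimes> T y" if xy: "x \<in> carrier G" "y \<in> carrier G" for x y
  proof (rule eqI)
    have "T x \<otimes> T y = (x \<otimes> \<phi> (T x)) \<otimes> (y \<otimes> \<phi> (T y))" using T(2) xy by metis
    also have "\<dots> = x \<otimes> y \<otimes> \<phi> (T x \<otimes> T y)" using xy T(1) by (simp add: m_ac)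
    finally show "T x \<otimes> T y = x \<otimes> y \<otimes> \<phi> (T x \<otimes> T y)" .
  qed (use xy T(1) in auto)
  then have "T \<in> hom G G" using T(1) by (auto intro: homI)
  moreover have "T x = x \<otimes> T (\<phi> x)" if x: "x \<in> carrier G" for x
  proof (rule eqI)
    have "T (\<phi> x) = \<phi> x \<otimes> \<phi> (T (\<phi> x))" using T(2) x by (meson hom_closed)
    then show "x \<otimes> T (\<phi> x) = x \<otimes> \<phi> (x \<otimes> T (\<phi> x))" using x T(1) by simp
  qed (use x T(1) in auto)
  ultimately show ?thesis using T(2,3) A_carrier by blast
qed

end

section \<open>The endomorphism ring of a commutative group\<close>

definition endomorphism_ring :: "('a, 'm) monoid_scheme \<Rightarrow> ('a \<Rightarrow> 'a) ring"
  where "endomorphism_ring G =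
    \<lparr>carrier = hom G G \<inter> extensional (carrier G),
     monoid.mult = compose (carrier G),
     one = (\<lambda>x\<in>carrier G. x),
     ring.zero = (\<lambda>x\<in>carrier G. \<one>\<^bsub>G\<^esub>),
     ring.add = (\<lambda>f g. \<lambda>x\<in>carrier G. f x \<otimes>\<^bsub>G\<^esub> g x)\<rparr>"

text \<open>Extensionality outside the carrier turns agreement on the carrier into equality of
  functions, as the unit and zero laws require.\<close>

lemma (in comm_group) endomorphism_ring: "ring (endomorphism_ring G)"
proof (rule ringI)
  show "abelian_group (endomorphism_ring G)"
  proof (rule abelian_groupI)
    fix f assume f: "f \<in> carrier (endomorphism_ring G)"
    then interpret group_hom G G f by unfold_locales (simp add: endomorphism_ring_def)
    have "(\<lambda>x\<in>carrier G. inv f x) \<in> carrier (endomorphism_ring G)"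
      by (auto simp: endomorphism_ring_def hom_def inv_mult)
    moreover have "(\<lambda>x\<in>carrier G. inv f x) \<oplus>\<^bsub>endomorphism_ring G\<^esub> f = \<zero>\<^bsub>endomorphism_ring G\<^esub>"
      by (auto simp: endomorphism_ring_def)
    ultimately show "\<exists>g\<in>carrier (endomorphism_ring G).
        g \<oplus>\<^bsub>endomorphism_ring G\<^esub> f = \<zero>\<^bsub>endomorphism_ring G\<^esub>" by blast
  qed (auto simp: endomorphism_ring_def hom_def m_ac Pi_iff extensional_def fun_eq_iff restrict_def)
  show "monoid (endomorphism_ring G)"
    by unfold_locales (auto simp: endomorphism_ring_def hom_def Pi_iff compose_def extensional_def fun_eq_iff)
qed (auto simp: endomorphism_ring_def hom_def Pi_iff compose_def extensional_def fun_eq_iff)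

subsection \<open>Graded maps as elements of an endomorphism ring\<close>

lemma comm_group_product_group:
  assumes "\<And>i. i \<in> I \<Longrightarrow> comm_group (G i)"
  shows "comm_group (product_group I G)"
proof (rule group.group_comm_groupI)
  show "group (product_group I G)"
    using assms by (simp add: comm_group.axioms(2))
  fix x y assume "x \<in> carrier (product_group I G)" "y \<in> carrier (product_group I G)"
  then show "x \<otimes>\<^bsub>product_group I G\<^esub> y = y \<otimes>\<^bsub>product_group I G\<^esub> x"
    using assms by (auto simp: fun_eq_iff PiE_iff intro!: comm_monoid.m_comm comm_group.axioms(1))
qed

text \<open>The target index is a separate variable, which makes the index arithmetic a side
  condition.\<close>

lemma graded_hom_apply:
  assumes "f \<in> graded_hom k V Y" "x \<in> carrier (V n)" "m = n + k"
  shows "f n x \<in> carrier (Y m)"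
  using assms by (auto simp: graded_hom_def hom_def)

lemma graded_hom_comp:
  assumes "f \<in> graded_hom k V Y" "g \<in> graded_hom l Y Z"
  shows "(\<lambda>n x. g (n + k) (f n x)) \<in> graded_hom (k + l) V Z"
  using assms by (auto simp: graded_hom_def hom_def Pi_iff simp flip: add.assoc)

lemma graded_hom_mult:
  assumes "\<And>n. comm_group (Y n)" "f \<in> graded_hom k V Y" "g \<in> graded_hom k V Y"
  shows "(\<lambda>n x. f n x \<otimes>\<^bsub>Y (n + k)\<^esub> g n x) \<in> graded_hom k V Y"
  using assms by (auto simp: graded_hom_def intro!: comm_group.hom_group_mult)

lemma graded_hom_inv:
  assumes "\<And>n. comm_group (Y n)" "f \<in> graded_hom k V Y"
  shows "(\<lambda>n x. inv\<^bsub>Y (n + k)\<^esub> f n x) \<in> graded_hom k V Y"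
proof -
  have "(\<lambda>x. inv\<^bsub>Y (n + k)\<^esub> f n x) \<in> hom (V n) (Y (n + k))" for n
  proof -
    interpret comm_group "Y (n + k)" by (rule assms)
    show ?thesis using assms(2) by (auto simp: graded_hom_def hom_def inv_mult Pi_iff)
  qed
  then show ?thesis by (simp add: graded_hom_def)
qed

locale graded_group =
  fixes K :: "int \<Rightarrow> ('c, 'k) monoid_scheme"
  assumes comm_K: "comm_group (K n)"
begin

abbreviation "P \<equiv> product_group UNIV K"
abbreviation "E \<equiv> endomorphism_ring P"

lemma group_K: "group (K n)"
  using comm_K comm_group.axioms(2) by blast

lemma comm_P: "comm_group P"
  by (rule comm_group_product_group) (rule comm_K)

sublocale ring E
  using comm_P by (rule comm_group.endomorphism_ring)

text \<open>
  A graded map of degree \<open>k\<close> between direct summands of \<open>K\<close> becomes an endomorphism of the product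
  of all \<open>K n\<close>. The set \<open>lifts k j\<close> consists of those that send \<open>F\<^sup>p\<close> to \<open>F\<^sup>p\<^sup>+\<^sup>j\<close>.
\<close>

definition summand ::
  "(int \<Rightarrow> ('x, 'xm) monoid_scheme) \<Rightarrow> (nat \<Rightarrow> int \<Rightarrow> 'x set) \<Rightarrow> ('c \<Rightarrow> 'x) \<Rightarrow> (int \<Rightarrow> 'x \<Rightarrow> 'c) \<Rightarrow> bool"
  where "summand V A \<pi> \<iota> \<longleftrightarrow>
    (\<forall>n. comm_group (V n) \<and> \<pi> \<in> hom (K n) (V n) \<and> \<iota> n \<in> hom (V n) (K n) \<and>
      (\<forall>x\<in>carrier (V n). \<pi> (\<iota> n x) = x)) \<and>
    (\<forall>p n. subgroup (A p n) (V n) \<and> A (Suc p) n \<subseteq> A p n)"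

definition lift :: "int \<Rightarrow> ('c \<Rightarrow> 'x) \<Rightarrow> (int \<Rightarrow> 'y \<Rightarrow> 'c) \<Rightarrow> (int \<Rightarrow> 'x \<Rightarrow> 'y) \<Rightarrow> (int \<Rightarrow> 'c) \<Rightarrow> int \<Rightarrow> 'c"
  where "lift k \<pi> \<iota> f = (\<lambda>s\<in>carrier P. \<lambda>m. \<iota> m (f (m - k) (\<pi> (s (m - k)))))"

definition lifts :: "int \<Rightarrow> nat \<Rightarrow> (int \<Rightarrow> ('x, 'xm) monoid_scheme) \<Rightarrow> (nat \<Rightarrow> int \<Rightarrow> 'x set) \<Rightarrow> ('c \<Rightarrow> 'x)
    \<Rightarrow> (int \<Rightarrow> ('y, 'ym) monoid_scheme) \<Rightarrow> (nat \<Rightarrow> int \<Rightarrow> 'y set) \<Rightarrow> (int \<Rightarrow> 'y \<Rightarrow> 'c)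
    \<Rightarrow> ((int \<Rightarrow> 'c) \<Rightarrow> int \<Rightarrow> 'c) set"
  where "lifts k j V A \<pi> Y B \<iota> =
    lift k \<pi> \<iota> ` {f \<in> graded_hom k V Y. \<forall>p n. f n ` A p n \<subseteq> B (p + j) (n + k)}"

lemma summandD:
  assumes "summand V A \<pi> \<iota>"
  shows "comm_group (V n)" "group (V n)" "\<pi> \<in> hom (K n) (V n)" "\<iota> n \<in> hom (V n) (K n)"
    "x \<in> carrier (V n) \<Longrightarrow> \<pi> (\<iota> n x) = x" "c \<in> carrier (K n) \<Longrightarrow> \<pi> c \<in> carrier (V n)"
    "x \<in> carrier (V n) \<Longrightarrow> \<iota> n x \<in> carrier (K n)"
    "subgroup (A p n) (V n)" "x \<in> A p n \<Longrightarrow> x \<in> carrier (V n)" "j \<le> i \<Longrightarrow> A i n \<subseteq> A j n"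
proof -
  show "comm_group (V n)" using assms by (simp add: summand_def)
  then show "group (V n)" by (rule comm_group.axioms(2))
  show "\<pi> \<in> hom (K n) (V n)" "\<iota> n \<in> hom (V n) (K n)"
    "x \<in> carrier (V n) \<Longrightarrow> \<pi> (\<iota> n x) = x" "c \<in> carrier (K n) \<Longrightarrow> \<pi> c \<in> carrier (V n)"
    "x \<in> carrier (V n) \<Longrightarrow> \<iota> n x \<in> carrier (K n)" "subgroup (A p n) (V n)"
    using assms by (auto simp: summand_def hom_def)
  then show "x \<in> A p n \<Longrightarrow> x \<in> carrier (V n)" by (meson subgroup.mem_carrier)
  show "j \<le> i \<Longrightarrow> A i n \<subseteq> A j n"
    by (rule lift_Suc_antimono_le[of "\<lambda>p. A p n"]) (use assms in \<open>simp_all add: summand_def\<close>)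
qed

lemma carrier_P: "s \<in> carrier P \<longleftrightarrow> (\<forall>n. s n \<in> carrier (K n))"
  by (auto simp: PiE_iff)

lemma lift_apply: "s \<in> carrier P \<Longrightarrow> lift k \<pi> \<iota> f s m = \<iota> m (f (m - k) (\<pi> (s (m - k))))"
  by (simp add: lift_def)

lemma lift_eqI:
  assumes "u \<in> carrier E" "\<And>s m. s \<in> carrier P \<Longrightarrow> u s m = \<iota> m (f (m - k) (\<pi> (s (m - k))))"
  shows "u = lift k \<pi> \<iota> f"
  using assms unfolding lift_def endomorphism_ring_def
  by (auto simp: fun_eq_iff extensional_def restrict_def)

lemma lift_closed:
  assumes "summand V A \<pi> \<iota>V" "summand Y B \<pi>Y \<iota>" "f \<in> graded_hom k V Y"
  shows "lift k \<pi> \<iota> f \<in> carrier E"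
proof -
  have "(\<lambda>c. \<iota> m (f (m - k) (\<pi> c))) \<in> hom (K (m - k)) (K m)" for m
  proof -
    have "f (m - k) \<in> hom (V (m - k)) (Y m)"
      using assms(3) by (auto simp: graded_hom_def dest!: spec[of _ "m - k"])
    then show ?thesis
      using summandD(3)[OF assms(1), of "m - k"] summandD(4)[OF assms(2), of m]
      by (auto simp: hom_def Pi_iff)
  qed
  then show ?thesis
    by (auto simp: endomorphism_ring_def hom_def lift_def Pi_iff PiE_iff fun_eq_iff restrict_def extensional_def
        intro: group.is_monoid[OF group_K, THEN monoid.m_closed])
qed

lemma lift_eq_iff:
  assumes V: "summand V A \<pi> \<iota>V" and Y: "summand Y B \<pi>Y \<iota>"
    and f: "f \<in> graded_hom k V Y" and g: "g \<in> graded_hom k V Y"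
  shows "lift k \<pi> \<iota> f = lift k \<pi> \<iota> g \<longleftrightarrow> (\<forall>n. \<forall>x\<in>carrier (V n). f n x = g n x)"
proof (intro iffI allI ballI)
  fix n x
  assume eq: "lift k \<pi> \<iota> f = lift k \<pi> \<iota> g" and x: "x \<in> carrier (V n)"
  \<comment> \<open>A family concentrated in degree \<open>n\<close> isolates the value at
    \<open>x\<close> in component \<open>n + k\<close>.\<close>
  define s where "s = (\<lambda>m. if m = n then \<iota>V n x else \<one>\<^bsub>K m\<^esub>)"
  have s: "s \<in> carrier P"
    using summandD(7)[OF V x] group.is_monoid[OF group_K, THEN monoid.one_closed] by (auto simp: carrier_P s_def simp del: carrier_product_group)
  have "\<pi>Y (lift k \<pi> \<iota> h s (n + k)) = h n x" if "h \<in> graded_hom k V Y" for h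
    using that x s graded_hom_apply[OF that x] summandD(5)[OF V x] summandD(5)[OF Y]
    by (simp add: lift_apply s_def)
  then show "f n x = g n x" using eq f g by metis
next
  assume "\<forall>n. \<forall>x\<in>carrier (V n). f n x = g n x"
  then show "lift k \<pi> \<iota> f = lift k \<pi> \<iota> g"
    using summandD(6)[OF V] by (auto simp: lift_def fun_eq_iff carrier_P restrict_def simp del: carrier_product_group)
qed

lemma lift_comp:
  assumes V: "summand V A \<pi>V \<iota>V" and Y: "summand Y B \<pi>Y \<iota>Y" and Z: "summand Z C \<pi>Z \<iota>Z"
    and f: "f \<in> graded_hom k V Y" and g: "g \<in> graded_hom l Y Z"
  shows "lift l \<pi>Y \<iota>Z g \<otimes>\<^bsub>E\<^esub> lift k \<pi>V \<iota>Y f = lift (k + l) \<pi>V \<iota>Z (\<lambda>n x. g (n + k) (f n x))"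
proof (rule lift_eqI)
  have closed: "lift l \<pi>Y \<iota>Z g \<in> carrier E" "lift k \<pi>V \<iota>Y f \<in> carrier E"
    using lift_closed V Y Z f g by blast+
  then show "lift l \<pi>Y \<iota>Z g \<otimes>\<^bsub>E\<^esub> lift k \<pi>V \<iota>Y f \<in> carrier E" by simp
  fix s m assume s: "s \<in> carrier P"
  have fs: "lift k \<pi>V \<iota>Y f s \<in> carrier P"
    using closed(2) s by (auto simp: endomorphism_ring_def hom_def)
  have "f (m - l - k) (\<pi>V (s (m - l - k))) \<in> carrier (Y (m - l))"
    using s summandD(6)[OF V] by (auto intro!: graded_hom_apply[OF f] simp: carrier_P)
  then have "(lift l \<pi>Y \<iota>Z g \<otimes>\<^bsub>E\<^esub> lift k \<pi>V \<iota>Y f) s m = \<iota>Z m (g (m - l) (f (m - l - k) (\<pi>V (s (m - l - k)))))"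
    using s summandD(5)[OF Y] by (simp add: endomorphism_ring_def compose_def lift_apply[OF fs] lift_apply[OF s])
  moreover have "m - l = m - (k + l) + k" "m - l - k = m - (k + l)" by simp_all
  ultimately show "(lift l \<pi>Y \<iota>Z g \<otimes>\<^bsub>E\<^esub> lift k \<pi>V \<iota>Y f) s m
      = \<iota>Z m (g (m - (k + l) + k) (f (m - (k + l)) (\<pi>V (s (m - (k + l))))))"
    by metis
qed

lemma lift_add:
  assumes V: "summand V A \<pi> \<iota>V" and Y: "summand Y B \<pi>Y \<iota>"
    and f: "f \<in> graded_hom k V Y" and g: "g \<in> graded_hom k V Y"
  shows "lift k \<pi> \<iota> f \<oplus>\<^bsub>E\<^esub> lift k \<pi> \<iota> g = lift k \<pi> \<iota> (\<lambda>n x. f n x \<otimes>\<^bsub>Y (n + k)\<^esub> g n x)"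
proof (rule lift_eqI)
  show "lift k \<pi> \<iota> f \<oplus>\<^bsub>E\<^esub> lift k \<pi> \<iota> g \<in> carrier E"
    using lift_closed[OF V Y] f g by simp
  fix s m assume s: "s \<in> carrier P"
  have "h (m - k) (\<pi> (s (m - k))) \<in> carrier (Y m)" if "h \<in> graded_hom k V Y" for h
    using s summandD(6)[OF V] by (auto intro!: graded_hom_apply[OF that] simp: carrier_P)
  then show "(lift k \<pi> \<iota> f \<oplus>\<^bsub>E\<^esub> lift k \<pi> \<iota> g) s m
      = \<iota> m (f (m - k) (\<pi> (s (m - k))) \<otimes>\<^bsub>Y (m - k + k)\<^esub> g (m - k) (\<pi> (s (m - k))))"
    using s f g hom_mult[OF summandD(4)[OF Y]]
    by (simp add: endomorphism_ring_def lift_apply del: carrier_product_group)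
qed

lemma lift_one:
  assumes V: "summand V A \<pi> \<iota>V" and Y: "summand Y B \<pi>Y \<iota>"
  shows "lift k \<pi> \<iota> (\<lambda>n x. \<one>\<^bsub>Y (n + k)\<^esub>) = \<zero>\<^bsub>E\<^esub>"
  using hom_one[OF summandD(4)[OF Y] summandD(2)[OF Y] group_K]
  by (auto simp: lift_def endomorphism_ring_def fun_eq_iff restrict_def)

lemma graded_hom_one:
  assumes "\<And>n. group (Y n)"
  shows "(\<lambda>n x. \<one>\<^bsub>Y (n + k)\<^esub>) \<in> graded_hom k V Y"
  using assms by (auto simp: graded_hom_def intro!: trivial_hom)

lemma lift_inv:
  assumes V: "summand V A \<pi> \<iota>V" and Y: "summand Y B \<pi>Y \<iota>" and f: "f \<in> graded_hom k V Y"
  shows "\<ominus>\<^bsub>E\<^esub> lift k \<pi> \<iota> f = lift k \<pi> \<iota> (\<lambda>n x. inv\<^bsub>Y (n + k)\<^esub> f n x)"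
proof (rule minus_equality)
  have f': "(\<lambda>n x. inv\<^bsub>Y (n + k)\<^esub> f n x) \<in> graded_hom k V Y"
    using summandD(1)[OF Y] f by (rule graded_hom_inv)
  have "lift k \<pi> \<iota> (\<lambda>n x. inv\<^bsub>Y (n + k)\<^esub> f n x) \<oplus>\<^bsub>E\<^esub> lift k \<pi> \<iota> f = lift k \<pi> \<iota> (\<lambda>n x. \<one>\<^bsub>Y (n + k)\<^esub>)"
    unfolding lift_add[OF V Y f' f]
    using f f' graded_hom_apply[OF f] group.l_inv[OF summandD(2)[OF Y]] summandD(1,2)[OF Y]
    by (subst lift_eq_iff[OF V Y]) (auto intro!: graded_hom_mult graded_hom_one)
  then show "lift k \<pi> \<iota> (\<lambda>n x. inv\<^bsub>Y (n + k)\<^esub> f n x) \<oplus>\<^bsub>E\<^esub> lift k \<pi> \<iota> f = \<zero>\<^bsub>E\<^esub>"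
    by (simp add: lift_one[OF V Y])
  show "lift k \<pi> \<iota> f \<in> carrier E" "lift k \<pi> \<iota> (\<lambda>n x. inv\<^bsub>Y (n + k)\<^esub> f n x) \<in> carrier E"
    using lift_closed[OF V Y] f f' by auto
qed

lemma lift_diff:
  assumes V: "summand V A \<pi> \<iota>V" and Y: "summand Y B \<pi>Y \<iota>"
    and f: "f \<in> graded_hom k V Y" and g: "g \<in> graded_hom k V Y"
  shows "lift k \<pi> \<iota> f \<ominus>\<^bsub>E\<^esub> lift k \<pi> \<iota> g = lift k \<pi> \<iota> (\<lambda>n x. f n x \<otimes>\<^bsub>Y (n + k)\<^esub> inv\<^bsub>Y (n + k)\<^esub> g n x)"
  unfolding a_minus_def lift_inv[OF V Y g]
  by (rule lift_add[OF V Y f graded_hom_inv[OF summandD(1)[OF Y] g]])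

lemma liftsI:
  assumes "f \<in> graded_hom k V Y" "\<And>p n x. x \<in> A p n \<Longrightarrow> f n x \<in> B (p + j) (n + k)"
  shows "lift k \<pi> \<iota> f \<in> lifts k j V A \<pi> Y B \<iota>"
  using assms by (auto simp: lifts_def)

lemma liftsE:
  assumes "u \<in> lifts k j V A \<pi> Y B \<iota>"
  obtains f where "u = lift k \<pi> \<iota> f" "f \<in> graded_hom k V Y" "\<And>p n x. x \<in> A p n \<Longrightarrow> f n x \<in> B (p + j) (n + k)"
  using assms unfolding lifts_def by blast

text \<open>Degrees and filtration gains add up. The inequality for \<open>h\<close> allows part of
  the gain to be forgotten.\<close>

lemma lifts_comp:
  assumes V: "summand V A \<pi>V \<iota>V" and Y: "summand Y B \<pi>Y \<iota>Y" and Z: "summand Z C \<pi>Z \<iota>Z"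
    and u: "u \<in> lifts k j V A \<pi>V Y B \<iota>Y" and v: "v \<in> lifts l i Y B \<pi>Y Z C \<iota>Z"
    and "m = k + l" "h \<le> j + i"
  shows "v \<otimes>\<^bsub>E\<^esub> u \<in> lifts m h V A \<pi>V Z C \<iota>Z"
proof -
  obtain f where f: "u = lift k \<pi>V \<iota>Y f" "f \<in> graded_hom k V Y" "\<And>p n x. x \<in> A p n \<Longrightarrow> f n x \<in> B (p + j) (n + k)"
    using u by (elim liftsE) blast
  obtain g where g: "v = lift l \<pi>Y \<iota>Z g" "g \<in> graded_hom l Y Z" "\<And>p n x. x \<in> B p n \<Longrightarrow> g n x \<in> C (p + i) (n + l)"
    using v by (elim liftsE) blast
  show ?thesis
    unfolding f(1) g(1) lift_comp[OF V Y Z f(2) g(2)] \<open>m = k + l\<close>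
  proof (rule liftsI)
    fix p n x assume "x \<in> A p n"
    then have "g (n + k) (f n x) \<in> C (p + j + i) (n + k + l)" using f(3) g(3) by blast
    moreover have "C (p + j + i) (n + k + l) \<subseteq> C (p + h) (n + k + l)"
      using summandD(10)[OF Z] assms(7) by simp
    ultimately show "g (n + k) (f n x) \<in> C (p + h) (n + (k + l))" by (auto simp: add.assoc)
  qed (rule graded_hom_comp[OF f(2) g(2)])
qed

lemma lifts_add:
  assumes V: "summand V A \<pi> \<iota>V" and Y: "summand Y B \<pi>Y \<iota>"
    and u: "u \<in> lifts k j V A \<pi> Y B \<iota>" and v: "v \<in> lifts k j V A \<pi> Y B \<iota>"
  shows "u \<oplus>\<^bsub>E\<^esub> v \<in> lifts k j V A \<pi> Y B \<iota>"
proof -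
  obtain f where f: "u = lift k \<pi> \<iota> f" "f \<in> graded_hom k V Y" "\<And>p n x. x \<in> A p n \<Longrightarrow> f n x \<in> B (p + j) (n + k)"
    using u by (elim liftsE) blast
  obtain g where g: "v = lift k \<pi> \<iota> g" "g \<in> graded_hom k V Y" "\<And>p n x. x \<in> A p n \<Longrightarrow> g n x \<in> B (p + j) (n + k)"
    using v by (elim liftsE) blast
  show ?thesis
    unfolding f(1) g(1) lift_add[OF V Y f(2) g(2)]
    using summandD(1)[OF Y] f(2,3) g(2,3) subgroup.m_closed[OF summandD(8)[OF Y]]
    by (intro liftsI graded_hom_mult) auto
qed

lemma lifts_inv:
  assumes V: "summand V A \<pi> \<iota>V" and Y: "summand Y B \<pi>Y \<iota>" and u: "u \<in> lifts k j V A \<pi> Y B \<iota>"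
  shows "\<ominus>\<^bsub>E\<^esub> u \<in> lifts k j V A \<pi> Y B \<iota>"
proof -
  obtain f where f: "u = lift k \<pi> \<iota> f" "f \<in> graded_hom k V Y" "\<And>p n x. x \<in> A p n \<Longrightarrow> f n x \<in> B (p + j) (n + k)"
    using u by (elim liftsE) blast
  show ?thesis
    unfolding f(1) lift_inv[OF V Y f(2)]
    using summandD(1)[OF Y] f(2,3) subgroup.m_inv_closed[OF summandD(8)[OF Y]]
    by (intro liftsI graded_hom_inv) auto
qed

lemma lifts_diff:
  assumes V: "summand V A \<pi> \<iota>V" and Y: "summand Y B \<pi>Y \<iota>"
    and "u \<in> lifts k j V A \<pi> Y B \<iota>" "v \<in> lifts k j V A \<pi> Y B \<iota>"
  shows "u \<ominus>\<^bsub>E\<^esub> v \<in> lifts k j V A \<pi> Y B \<iota>"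
  unfolding a_minus_def using assms by (intro lifts_add[OF V Y] lifts_inv[OF V Y])

section \<open>Equations between graded maps as ring identities\<close>

lemma lift_id_comp:
  assumes V: "summand V A \<pi>V \<iota>V" and Y: "summand Y B \<pi>Y \<iota>Y" and f: "f \<in> graded_hom k V Y"
  shows "lift k \<pi>V \<iota>Y f \<otimes>\<^bsub>E\<^esub> lift 0 \<pi>V \<iota>V (\<lambda>n x. x) = lift k \<pi>V \<iota>Y f"
    and "lift 0 \<pi>Y \<iota>Y (\<lambda>n x. x) \<otimes>\<^bsub>E\<^esub> lift k \<pi>V \<iota>Y f = lift k \<pi>V \<iota>Y f"
proof -
  have id: "(\<lambda>n x. x) \<in> graded_hom 0 Z Z" for Z :: "int \<Rightarrow> ('z, 'zm) monoid_scheme"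
    by (simp add: graded_hom_def hom_def)
  show "lift k \<pi>V \<iota>Y f \<otimes>\<^bsub>E\<^esub> lift 0 \<pi>V \<iota>V (\<lambda>n x. x) = lift k \<pi>V \<iota>Y f"
    using lift_comp[OF V V Y id f] by simp
  show "lift 0 \<pi>Y \<iota>Y (\<lambda>n x. x) \<otimes>\<^bsub>E\<^esub> lift k \<pi>V \<iota>Y f = lift k \<pi>V \<iota>Y f"
    using lift_comp[OF V Y Y f id] by simp
qed

lemma lift_chain_iff:
  assumes V: "summand V A \<pi>V \<iota>V" and Y: "summand Y B \<pi>Y \<iota>Y"
    and f: "f \<in> graded_hom 0 V Y" and d: "d \<in> graded_hom (- 1) V V" and e: "e \<in> graded_hom (- 1) Y Y"
  shows "lift 0 \<pi>V \<iota>Y f \<otimes>\<^bsub>E\<^esub> lift (- 1) \<pi>V \<iota>V d = lift (- 1) \<pi>Y \<iota>Y e \<otimes>\<^bsub>E\<^esub> lift 0 \<pi>V \<iota>Y f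
    \<longleftrightarrow> (\<forall>n. \<forall>x\<in>carrier (V n). f (n - 1) (d n x) = e n (f n x))"
  unfolding lift_comp[OF V V Y d f] lift_comp[OF V Y Y f e]
  using lift_eq_iff[OF V Y graded_hom_comp[OF d f]] graded_hom_comp[OF f e] by simp

lemma lift_square_iff:
  assumes V: "summand V A \<pi> \<iota>" and d: "d \<in> graded_hom (- 1) V V"
  shows "lift (- 1) \<pi> \<iota> d \<otimes>\<^bsub>E\<^esub> lift (- 1) \<pi> \<iota> d = \<zero>\<^bsub>E\<^esub> \<longleftrightarrow> square_zero V d"
  unfolding lift_comp[OF V V V d d] square_zero_def lift_one[OF V V, of "- 2", symmetric]
  using lift_eq_iff[OF V V graded_hom_comp[OF d d]] graded_hom_one[of V "- 2" V] summandD(2)[OF V] by simp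

text \<open>The ring form keeps the identity on the right, the graded form subtracts it on the left.
  Exchanging the two complexes covers the other homotopy equation.\<close>

lemma lift_homotopy_iff:
  assumes V: "summand V A \<pi>V \<iota>V" and Y: "summand Y B \<pi>Y \<iota>Y"
    and f: "f \<in> graded_hom 0 V Y" and g: "g \<in> graded_hom 0 Y V"
    and d: "d \<in> graded_hom (- 1) V V" and h: "h \<in> graded_hom 1 V V"
  shows "lift 0 \<pi>Y \<iota>V g \<otimes>\<^bsub>E\<^esub> lift 0 \<pi>V \<iota>Y f = lift 0 \<pi>V \<iota>V (\<lambda>n x. x) \<oplus>\<^bsub>E\<^esub>
      (lift (- 1) \<pi>V \<iota>V d \<otimes>\<^bsub>E\<^esub> lift 1 \<pi>V \<iota>V h \<oplus>\<^bsub>E\<^esub> lift 1 \<pi>V \<iota>V h \<otimes>\<^bsub>E\<^esub> lift (- 1) \<pi>V \<iota>V d)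
    \<longleftrightarrow> (\<forall>n. \<forall>x\<in>carrier (V n). g n (f n x) \<otimes>\<^bsub>V n\<^esub> inv\<^bsub>V n\<^esub> x = d (n + 1) (h n x) \<otimes>\<^bsub>V n\<^esub> h (n - 1) (d n x))"
proof -
  note comm = summandD(1)[OF V]
  have id: "(\<lambda>n x. x) \<in> graded_hom 0 V V" by (simp add: graded_hom_def hom_def)
  have dh: "(\<lambda>n x. d (n + 1) (h n x)) \<in> graded_hom 0 V V" using graded_hom_comp[OF h d] by simp
  have hd: "(\<lambda>n x. h (n - 1) (d n x)) \<in> graded_hom 0 V V" using graded_hom_comp[OF d h] by simp
  have gf: "(\<lambda>n x. g n (f n x)) \<in> graded_hom 0 V V" using graded_hom_comp[OF f g] by simp
  note sum = graded_hom_mult[OF comm dh hd]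
  have eqs: "lift 0 \<pi>Y \<iota>V g \<otimes>\<^bsub>E\<^esub> lift 0 \<pi>V \<iota>Y f = lift 0 \<pi>V \<iota>V (\<lambda>n x. g n (f n x))"
    "lift (- 1) \<pi>V \<iota>V d \<otimes>\<^bsub>E\<^esub> lift 1 \<pi>V \<iota>V h = lift 0 \<pi>V \<iota>V (\<lambda>n x. d (n + 1) (h n x))"
    "lift 1 \<pi>V \<iota>V h \<otimes>\<^bsub>E\<^esub> lift (- 1) \<pi>V \<iota>V d = lift 0 \<pi>V \<iota>V (\<lambda>n x. h (n - 1) (d n x))"
    using lift_comp[OF V Y V f g] lift_comp[OF V V V h d] lift_comp[OF V V V d h] by simp_all
  have "(a = x \<otimes>\<^bsub>V n\<^esub> b) \<longleftrightarrow> (a \<otimes>\<^bsub>V n\<^esub> inv\<^bsub>V n\<^esub> x = b)"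
    if "a \<in> carrier (V n)" "b \<in> carrier (V n)" "x \<in> carrier (V n)" for a b x n
  proof -
    interpret comm_group "V n" by (rule comm)
    show ?thesis using that by (metis inv_solve_right' m_comm m_closed)
  qed
  note rearrange = this
  show ?thesis
    unfolding eqs lift_add[OF V V dh hd] lift_add[OF V V id sum]
      lift_eq_iff[OF V V gf graded_hom_mult[OF comm id sum]]
    using graded_hom_apply[OF gf] graded_hom_apply[OF sum] by (auto simp: rearrange)
qed

text \<open>The definition of a perturbation measures \<open>f - g\<close>, while the ring
  computations produce \<open>g - f\<close>; the filtration consists of subgroups, so the sign is
  harmless.\<close>

lemma lift_perturbation:
  assumes V: "summand V A \<pi> \<iota>V" and Y: "summand Y B \<pi>Y \<iota>"
    and f: "f \<in> graded_hom k V Y" and g: "g \<in> graded_hom k V Y"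
  shows "lift k \<pi> \<iota> g \<ominus>\<^bsub>E\<^esub> lift k \<pi> \<iota> f \<in> lifts k 1 V A \<pi> Y B \<iota> \<longleftrightarrow> perturbation k V A Y B f g"
proof -
  let ?fg = "\<lambda>n x. f n x \<otimes>\<^bsub>Y (n + k)\<^esub> inv\<^bsub>Y (n + k)\<^esub> g n x"
  have fg: "?fg \<in> graded_hom k V Y"
    using f g summandD(1)[OF Y] by (intro graded_hom_mult graded_hom_inv)
  have neg: "lift k \<pi> \<iota> f \<ominus>\<^bsub>E\<^esub> lift k \<pi> \<iota> g = \<ominus>\<^bsub>E\<^esub> (lift k \<pi> \<iota> g \<ominus>\<^bsub>E\<^esub> lift k \<pi> \<iota> f)"
    using lift_closed[OF V Y f] lift_closed[OF V Y g] by (simp add: a_minus_def minus_add a_comm)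
  have "lift k \<pi> \<iota> g \<ominus>\<^bsub>E\<^esub> lift k \<pi> \<iota> f \<in> lifts k 1 V A \<pi> Y B \<iota>
      \<longleftrightarrow> lift k \<pi> \<iota> ?fg \<in> lifts k 1 V A \<pi> Y B \<iota>"
    unfolding lift_diff[OF V Y f g, symmetric] neg
    using lifts_inv[OF V Y] lift_closed[OF V Y f] lift_closed[OF V Y g]
    by (metis minus_closed minus_minus)
  also have "\<dots> \<longleftrightarrow> (\<forall>p n. \<forall>x\<in>A p n. ?fg n x \<in> B (Suc p) (n + k))"
  proof (intro iffI allI ballI)
    fix p n x assume "lift k \<pi> \<iota> ?fg \<in> lifts k 1 V A \<pi> Y B \<iota>" and x: "x \<in> A p n"
    \<comment> \<open>Membership in \<open>lifts\<close> only yields some representative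
      \<open>h\<close>; equal lifts agree on the carriers, hence on \<open>A p n\<close>.\<close>
    then obtain h where h: "lift k \<pi> \<iota> ?fg = lift k \<pi> \<iota> h" "h \<in> graded_hom k V Y"
      "\<And>p n x. x \<in> A p n \<Longrightarrow> h n x \<in> B (p + 1) (n + k)" by (elim liftsE) blast
    then have "?fg n x = h n x"
      using lift_eq_iff[OF V Y fg h(2)] summandD(9)[OF V x] by blast
    then show "?fg n x \<in> B (Suc p) (n + k)" using h(3)[OF x] by simp
  next
    assume "\<forall>p n. \<forall>x\<in>A p n. ?fg n x \<in> B (Suc p) (n + k)"
    then show "lift k \<pi> \<iota> ?fg \<in> lifts k 1 V A \<pi> Y B \<iota>" by (intro liftsI fg) simp
  qed
  also have "\<dots> \<longleftrightarrow> perturbation k V A Y B f g" using g by (simp add: perturbation_def)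
  finally show ?thesis .
qed

lemma lifts_closed:
  assumes V: "summand V A \<pi> \<iota>V" and Y: "summand Y B \<pi>Y \<iota>" and u: "u \<in> lifts k j V A \<pi> Y B \<iota>"
  shows "u \<in> carrier E"
  using u by (elim liftsE) (use lift_closed[OF V Y] in blast)

text \<open>Take \<open>S = r t\<close>, where \<open>t\<close> is the geometric series of
  \<open>h r\<close>. The map \<open>h r\<close> has degree 0 and raises the filtration by one, so
  the series can be summed in each degree separately.\<close>

lemma geometric_series_lift:
  assumes V: "summand V A \<pi> \<iota>" and A0: "\<And>n. A 0 n = carrier (V n)"
    and complete: "complete_filtration V A"
    and r: "r \<in> lifts (- 1) 1 V A \<pi> V A \<iota>" and h: "h \<in> lifts 1 0 V A \<pi> V A \<iota>"
  obtains S where "S \<in> lifts (- 1) 1 V A \<pi> V A \<iota>"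
    "S = r \<oplus>\<^bsub>E\<^esub> r \<otimes>\<^bsub>E\<^esub> (h \<otimes>\<^bsub>E\<^esub> S)" "S = r \<oplus>\<^bsub>E\<^esub> S \<otimes>\<^bsub>E\<^esub> (h \<otimes>\<^bsub>E\<^esub> r)"
proof -
  note closed = lifts_closed[OF V V]
  have hr: "h \<otimes>\<^bsub>E\<^esub> r \<in> lifts 0 1 V A \<pi> V A \<iota>"
    by (rule lifts_comp[OF V V V r h]) simp_all
  then obtain \<phi> where \<phi>: "h \<otimes>\<^bsub>E\<^esub> r = lift 0 \<pi> \<iota> \<phi>" "\<phi> \<in> graded_hom 0 V V"
    "\<And>p n x. x \<in> A p n \<Longrightarrow> \<phi> n x \<in> A (p + 1) (n + 0)" by (elim liftsE) blast
  have "\<exists>T\<in>hom (V n) (V n). (\<forall>p. T ` A p n \<subseteq> A p n) \<and>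
      (\<forall>x\<in>carrier (V n). T x = x \<otimes>\<^bsub>V n\<^esub> \<phi> n (T x)) \<and> (\<forall>x\<in>carrier (V n). T x = x \<otimes>\<^bsub>V n\<^esub> T (\<phi> n x))" for n
  proof -
    interpret complete_filtered_group "V n" "\<lambda>p. A p n"
      by (rule complete_filtered_group.intro[OF summandD(1)[OF V] complete_filtered_group_axioms.intro])
        (use summandD(8,10)[OF V] A0 complete in \<open>auto simp: complete_filtration_def\<close>)
    show ?thesis
      by (rule geometric_series) (use \<phi>(2,3) in \<open>auto simp: graded_hom_def\<close>)
  qed
  then obtain T where T: "\<And>n. T n \<in> hom (V n) (V n)" "\<And>n p x. x \<in> A p n \<Longrightarrow> T n x \<in> A p n"
    "\<And>n x. x \<in> carrier (V n) \<Longrightarrow> T n x = x \<otimes>\<^bsub>V n\<^esub> \<phi> n (T n x)"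
    "\<And>n x. x \<in> carrier (V n) \<Longrightarrow> T n x = x \<otimes>\<^bsub>V n\<^esub> T n (\<phi> n x)"
    by (metis image_subset_iff)
  define t where "t = lift 0 \<pi> \<iota> T"
  \<comment> \<open>This is the identity of the summand \<open>V\<close>, in general not the unit of
    \<open>E\<close>; it still acts as a unit on \<open>r\<close>.\<close>
  define one where "one = lift 0 \<pi> \<iota> (\<lambda>n x. x)"
  have id: "(\<lambda>n x. x) \<in> graded_hom 0 V V" by (simp add: graded_hom_def hom_def)
  have T': "T \<in> graded_hom 0 V V" using T(1) by (simp add: graded_hom_def)
  have t: "t \<in> lifts 0 0 V A \<pi> V A \<iota>" unfolding t_def using T' T(2) by (intro liftsI) auto
  have one: "one \<in> carrier E" unfolding one_def by (rule lift_closed[OF V V id])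
  have comps: "(\<lambda>n x. \<phi> n (T n x)) \<in> graded_hom 0 V V" "(\<lambda>n x. T n (\<phi> n x)) \<in> graded_hom 0 V V"
    using graded_hom_comp[OF T' \<phi>(2)] graded_hom_comp[OF \<phi>(2) T'] by simp_all
  have t_eq: "t = one \<oplus>\<^bsub>E\<^esub> (h \<otimes>\<^bsub>E\<^esub> r) \<otimes>\<^bsub>E\<^esub> t" "t = one \<oplus>\<^bsub>E\<^esub> t \<otimes>\<^bsub>E\<^esub> (h \<otimes>\<^bsub>E\<^esub> r)"
    unfolding \<phi>(1) t_def one_def lift_comp[OF V V V T' \<phi>(2)] lift_comp[OF V V V \<phi>(2) T']
    using lift_add[OF V V id comps(1)] lift_add[OF V V id comps(2)] T(3,4)
      lift_eq_iff[OF V V T' graded_hom_mult[OF summandD(1)[OF V] id comps(1)]]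
      lift_eq_iff[OF V V T' graded_hom_mult[OF summandD(1)[OF V] id comps(2)]]
    by simp_all
  have r_one: "r \<otimes>\<^bsub>E\<^esub> one = r"
    using r unfolding one_def by (elim liftsE) (simp add: lift_id_comp[OF V V])
  note mem [simp] = closed[OF r] closed[OF h] closed[OF t] one
  show thesis
  proof (rule that[of "r \<otimes>\<^bsub>E\<^esub> t"])
    show "r \<otimes>\<^bsub>E\<^esub> t \<in> lifts (- 1) 1 V A \<pi> V A \<iota>"
      by (rule lifts_comp[OF V V V t r]) simp_all
    have "r \<otimes>\<^bsub>E\<^esub> t = r \<otimes>\<^bsub>E\<^esub> (one \<oplus>\<^bsub>E\<^esub> (h \<otimes>\<^bsub>E\<^esub> r) \<otimes>\<^bsub>E\<^esub> t)" using t_eq(1) by (rule arg_cong)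
    also have "\<dots> = r \<oplus>\<^bsub>E\<^esub> r \<otimes>\<^bsub>E\<^esub> (h \<otimes>\<^bsub>E\<^esub> (r \<otimes>\<^bsub>E\<^esub> t))"
      by (simp add: r_distr r_one m_assoc)
    finally show "r \<otimes>\<^bsub>E\<^esub> t = r \<oplus>\<^bsub>E\<^esub> r \<otimes>\<^bsub>E\<^esub> (h \<otimes>\<^bsub>E\<^esub> (r \<otimes>\<^bsub>E\<^esub> t))" .
    have "r \<otimes>\<^bsub>E\<^esub> t = r \<otimes>\<^bsub>E\<^esub> (one \<oplus>\<^bsub>E\<^esub> t \<otimes>\<^bsub>E\<^esub> (h \<otimes>\<^bsub>E\<^esub> r))" using t_eq(2) by (rule arg_cong)
    also have "\<dots> = r \<oplus>\<^bsub>E\<^esub> (r \<otimes>\<^bsub>E\<^esub> t) \<otimes>\<^bsub>E\<^esub> (h \<otimes>\<^bsub>E\<^esub> r)"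
      by (simp add: r_distr r_one m_assoc)
    finally show "r \<otimes>\<^bsub>E\<^esub> t = r \<oplus>\<^bsub>E\<^esub> (r \<otimes>\<^bsub>E\<^esub> t) \<otimes>\<^bsub>E\<^esub> (h \<otimes>\<^bsub>E\<^esub> r)" .
  qed
qed

text \<open>The way back from the ring to maps: adding a filtration-raising element to the lift of a
  filtered map gives the lift of a filtered perturbation.\<close>

lemma perturbation_exists:
  assumes V: "summand V A \<pi> \<iota>V" and Y: "summand Y B \<pi>Y \<iota>" and f: "f \<in> graded_hom k V Y"
    and lift_f: "lift k \<pi> \<iota> f \<in> lifts k 0 V A \<pi> Y B \<iota>" and u: "u \<in> lifts k 1 V A \<pi> Y B \<iota>"
  obtains g where "g \<in> filtered_hom k V A Y B" "lift k \<pi> \<iota> g = lift k \<pi> \<iota> f \<oplus>\<^bsub>E\<^esub> u"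
    "perturbation k V A Y B f g"
proof -
  have u0: "u \<in> lifts k 0 V A \<pi> Y B \<iota>"
    using u by (elim liftsE) (use summandD(10)[OF Y] in \<open>auto intro!: liftsI, (metis Suc_n_not_le_n nle_le subsetD)\<close>)
  obtain g where g: "lift k \<pi> \<iota> f \<oplus>\<^bsub>E\<^esub> u = lift k \<pi> \<iota> g" "g \<in> graded_hom k V Y"
    "\<And>p n x. x \<in> A p n \<Longrightarrow> g n x \<in> B (p + 0) (n + k)"
    using lifts_add[OF V Y lift_f u0] by (elim liftsE) blast
  have "lift k \<pi> \<iota> g \<ominus>\<^bsub>E\<^esub> lift k \<pi> \<iota> f = u"
    unfolding g(1)[symmetric] using lift_closed[OF V Y f] lifts_closed[OF V Y u]
    by (simp add: a_minus_def a_ac r_neg1 r_neg2 r_neg)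
  then have "perturbation k V A Y B f g"
    using lift_perturbation[OF V Y f g(2)] u by simp
  moreover have "g \<in> filtered_hom k V A Y B" using g(2,3) by (auto simp: filtered_hom_def)
  ultimately show thesis using that g(1) by metis
qed

lemma lift_corrected_homotopy:
  assumes V: "summand V A \<pi>V \<iota>V" and Y: "summand Y B \<pi>Y \<iota>Y"
    and F: "F \<in> graded_hom 0 V Y" and G: "G \<in> graded_hom 0 Y V"
    and H: "H \<in> graded_hom 1 V V" and L: "L \<in> graded_hom 1 Y Y"
  shows "corrected_homotopy V Y F G H L \<in> graded_hom 1 Y Y"
    and "lift 1 \<pi>Y \<iota>Y (corrected_homotopy V Y F G H L) = lift 1 \<pi>Y \<iota>Y L \<ominus>\<^bsub>E\<^esub> lift 0 \<pi>V \<iota>Y F \<otimes>\<^bsub>E\<^esub>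
      (lift 0 \<pi>Y \<iota>V G \<otimes>\<^bsub>E\<^esub> lift 1 \<pi>Y \<iota>Y L \<ominus>\<^bsub>E\<^esub> lift 1 \<pi>V \<iota>V H \<otimes>\<^bsub>E\<^esub> lift 0 \<pi>Y \<iota>V G)"
proof -
  note comm = summandD(1)[OF V] summandD(1)[OF Y]
  define u where "u = (\<lambda>n y. G (n + 1) (L n y) \<otimes>\<^bsub>V (n + 1)\<^esub> inv\<^bsub>V (n + 1)\<^esub> H n (G n y))"
  have GL: "(\<lambda>n y. G (n + 1) (L n y)) \<in> graded_hom 1 Y V" using graded_hom_comp[OF L G] by simp
  have HG: "(\<lambda>n y. H n (G n y)) \<in> graded_hom 1 Y V" using graded_hom_comp[OF G H] by simp
  have u: "u \<in> graded_hom 1 Y V"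
    unfolding u_def by (intro graded_hom_mult graded_hom_inv comm GL HG)
  have Fu: "(\<lambda>n y. F (n + 1) (u n y)) \<in> graded_hom 1 Y Y" using graded_hom_comp[OF u F] by simp
  have eq: "corrected_homotopy V Y F G H L = (\<lambda>n y. L n y \<otimes>\<^bsub>Y (n + 1)\<^esub> inv\<^bsub>Y (n + 1)\<^esub> F (n + 1) (u n y))"
    by (simp add: corrected_homotopy_def u_def)
  show "corrected_homotopy V Y F G H L \<in> graded_hom 1 Y Y"
    unfolding eq by (intro graded_hom_mult graded_hom_inv comm L Fu)
  show "lift 1 \<pi>Y \<iota>Y (corrected_homotopy V Y F G H L) = lift 1 \<pi>Y \<iota>Y L \<ominus>\<^bsub>E\<^esub> lift 0 \<pi>V \<iota>Y F \<otimes>\<^bsub>E\<^esub>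
      (lift 0 \<pi>Y \<iota>V G \<otimes>\<^bsub>E\<^esub> lift 1 \<pi>Y \<iota>Y L \<ominus>\<^bsub>E\<^esub> lift 1 \<pi>V \<iota>V H \<otimes>\<^bsub>E\<^esub> lift 0 \<pi>Y \<iota>V G)"
    unfolding eq lift_diff[OF Y Y L Fu, symmetric]
    using lift_comp[OF Y V Y u F] lift_diff[OF Y V GL HG, folded u_def]
      lift_comp[OF Y Y V L G] lift_comp[OF Y V V G H] by simp
qed

end

subsection \<open>The perturbed homotopy equivalence\<close>

lemma comm_group_DirProd:
  assumes "comm_group G" "comm_group H"
  shows "comm_group (G \<times>\<times> H)"
proof (rule group.group_comm_groupI)
  show "group (G \<times>\<times> H)" using assms by (simp add: DirProd_group comm_group.axioms(2))
qed (use assms in \<open>auto simp: comm_monoid.m_comm[OF comm_group.axioms(1)]\<close>)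

theorem mainTheorem3:
  fixes M :: "int \<Rightarrow> ('a, 'm) monoid_scheme" and A :: "nat \<Rightarrow> int \<Rightarrow> 'a set"
    and N :: "int \<Rightarrow> ('b, 'n) monoid_scheme" and B :: "nat \<Rightarrow> int \<Rightarrow> 'b set"
    and dM dM' :: "int \<Rightarrow> 'a \<Rightarrow> 'a" and dN :: "int \<Rightarrow> 'b \<Rightarrow> 'b"
    and F :: "int \<Rightarrow> 'a \<Rightarrow> 'b" and G :: "int \<Rightarrow> 'b \<Rightarrow> 'a"
    and H :: "int \<Rightarrow> 'a \<Rightarrow> 'a" and L :: "int \<Rightarrow> 'b \<Rightarrow> 'b"
  assumes "complete_filtered_complex M A dM"
    and "complete_filtered_complex N B dN"
    and "chain_homotopy_equivalence M A dM N B dN F G H L"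
    and "differential_perturbation M A dM dM'"
  shows "\<exists>dN' F' G' H' L'.
    differential_perturbation N B dN dN' \<and>
    chain_homotopy_equivalence M A dM' N B dN' F' G' H' L' \<and>
    perturbation 0 M A N B F F' \<and>
    perturbation 0 N B M A G G' \<and>
    perturbation 1 M A M A H H' \<and>
    perturbation 1 N B N B (corrected_homotopy M N F G H L) L'"
proof -
  have M_comm: "comm_group (M n)" and N_comm: "comm_group (N n)" for n
    using assms(1,2) by (auto simp: complete_filtered_complex_def chain_complex_def)
  then have M_group: "group (M n)" and N_group: "group (N n)" for n
    by (auto intro: comm_group.axioms(2))
  have A: "filtration M dM A" and B: "filtration N dN B"
    using assms(1,2) by (auto simp: complete_filtered_complex_def)
  \<comment> \<open>With \<open>M n \<times>\<times> N n\<close> in each degree, the maps within and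
    between the two complexes all become elements of one ring \<open>E\<close>.\<close>
  interpret graded_group "\<lambda>n. M n \<times>\<times> N n"
    by (rule graded_group.intro) (intro comm_group_DirProd M_comm N_comm)
  define \<iota>M :: "int \<Rightarrow> 'a \<Rightarrow> 'a \<times> 'b" where "\<iota>M = (\<lambda>n x. (x, \<one>\<^bsub>N n\<^esub>))"
  define \<iota>N :: "int \<Rightarrow> 'b \<Rightarrow> 'a \<times> 'b" where "\<iota>N = (\<lambda>n y. (\<one>\<^bsub>M n\<^esub>, y))"
  have M: "summand M A fst \<iota>M"
    using A M_comm N_group
    by (auto simp: summand_def filtration_def \<iota>M_def hom_def group.is_monoid monoid.one_closed)
  have N: "summand N B snd \<iota>N"
    using B N_comm M_group
    by (auto simp: summand_def filtration_def \<iota>N_def hom_def group.is_monoid monoid.one_closed)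

  have gd: "dM \<in> graded_hom (- 1) M M" "dN \<in> graded_hom (- 1) N N" "dM' \<in> graded_hom (- 1) M M"
    and sq: "square_zero M dM" "square_zero N dN" "square_zero M dM'"
    using assms by (auto simp: complete_filtered_complex_def chain_complex_def
        differential_perturbation_def perturbation_def)
  have gF: "F \<in> graded_hom 0 M N" "G \<in> graded_hom 0 N M" "H \<in> graded_hom 1 M M" "L \<in> graded_hom 1 N N"
    and fF: "F \<in> filtered_hom 0 M A N B" "G \<in> filtered_hom 0 N B M A"
      "H \<in> filtered_hom 1 M A M A" "L \<in> filtered_hom 1 N B N B"
    using assms(3) by (auto simp: chain_homotopy_equivalence_def filtered_hom_def)

  define p where "p = lift 0 fst \<iota>M (\<lambda>n x. x)"
  define q where "q = lift 0 snd \<iota>N (\<lambda>n y. y)"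
  define d where "d = lift (- 1) fst \<iota>M dM"
  define e where "e = lift (- 1) snd \<iota>N dN"
  define d' where "d' = lift (- 1) fst \<iota>M dM'"
  define f where "f = lift 0 fst \<iota>N F"
  define g where "g = lift 0 snd \<iota>M G"
  define h where "h = lift 1 fst \<iota>M H"
  define l where "l = lift 1 snd \<iota>N L"
  note defs = p_def q_def d_def e_def d'_def f_def g_def h_def l_def
  have f: "f \<in> lifts 0 0 M A fst N B \<iota>N" and g: "g \<in> lifts 0 0 N B snd M A \<iota>M"
    and h: "h \<in> lifts 1 0 M A fst M A \<iota>M" and l: "l \<in> lifts 1 0 N B snd N B \<iota>N"
    unfolding defs using fF by (auto simp: filtered_hom_def image_subset_iff intro!: liftsI)
  have e: "e \<in> lifts (- 1) 0 N B snd N B \<iota>N"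
    unfolding defs using B gd(2) by (auto simp: filtration_def image_subset_iff intro!: liftsI)

  \<comment> \<open>That \<open>dM'\<close> is a perturbation of \<open>dM\<close> says precisely
    that \<open>r\<close> raises the filtration by one.\<close>
  define r where "r = d' \<ominus>\<^bsub>E\<^esub> d"
  have r: "r \<in> lifts (- 1) 1 M A fst M A \<iota>M"
    unfolding r_def defs lift_perturbation[OF M M gd(1,3)]
    using assms(4) by (simp add: differential_perturbation_def)
  obtain S where S: "S \<in> lifts (- 1) 1 M A fst M A \<iota>M"
    and S_eq: "S = r \<oplus>\<^bsub>E\<^esub> r \<otimes>\<^bsub>E\<^esub> (h \<otimes>\<^bsub>E\<^esub> S)" "S = r \<oplus>\<^bsub>E\<^esub> S \<otimes>\<^bsub>E\<^esub> (h \<otimes>\<^bsub>E\<^esub> r)"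
  proof (rule geometric_series_lift[OF M _ _ r h])
    show "A 0 n = carrier (M n)" for n using A by (simp add: filtration_def)
    show "complete_filtration M A" using assms(1) by (simp add: complete_filtered_complex_def)
  qed
  have carr: "p \<in> carrier E" "q \<in> carrier E" "d \<in> carrier E" "d' \<in> carrier E" "e \<in> carrier E"
    "f \<in> carrier E" "g \<in> carrier E" "h \<in> carrier E" "l \<in> carrier E" "r \<in> carrier E" "S \<in> carrier E"
    unfolding defs using lift_closed[OF M M] lift_closed[OF M N] lift_closed[OF N M] lift_closed[OF N N]
      lifts_closed[OF M M] gd gF r S
    by (auto simp: graded_hom_def hom_def)
  have d'_eq: "d' = d \<oplus>\<^bsub>E\<^esub> r"
    using carr by (simp add: r_def a_minus_def a_lcomm r_neg)
  have squares: "d \<otimes>\<^bsub>E\<^esub> d = \<zero>\<^bsub>E\<^esub>" "e \<otimes>\<^bsub>E\<^esub> e = \<zero>\<^bsub>E\<^esub>" "d' \<otimes>\<^bsub>E\<^esub> d' = \<zero>\<^bsub>E\<^esub>"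
    unfolding defs using lift_square_iff[OF M] lift_square_iff[OF N] gd sq by auto
  have units: "p \<otimes>\<^bsub>E\<^esub> S = S" "S \<otimes>\<^bsub>E\<^esub> p = S"
    using S unfolding defs by (elim liftsE; simp add: lift_id_comp[OF M M])+

  interpret perturbed_homotopy_data E p q d e f g h l r S
  proof unfold_locales
    show "e \<otimes>\<^bsub>E\<^esub> f = f \<otimes>\<^bsub>E\<^esub> d"
      unfolding defs using lift_chain_iff[OF M N gF(1) gd(1,2)] assms(3)
      by (simp add: chain_homotopy_equivalence_def)
    show "g \<otimes>\<^bsub>E\<^esub> e = d \<otimes>\<^bsub>E\<^esub> g"
      unfolding defs using lift_chain_iff[OF N M gF(2) gd(2,1)] assms(3)
      by (simp add: chain_homotopy_equivalence_def)
    show "g \<otimes>\<^bsub>E\<^esub> f = p \<oplus>\<^bsub>E\<^esub> (d \<otimes>\<^bsub>E\<^esub> h \<oplus>\<^bsub>E\<^esub> h \<otimes>\<^bsub>E\<^esub> d)"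
      unfolding defs lift_homotopy_iff[OF M N gF(1,2) gd(1) gF(3)] using assms(3)
      by (simp add: chain_homotopy_equivalence_def)
    show "f \<otimes>\<^bsub>E\<^esub> g = q \<oplus>\<^bsub>E\<^esub> (e \<otimes>\<^bsub>E\<^esub> l \<oplus>\<^bsub>E\<^esub> l \<otimes>\<^bsub>E\<^esub> e)"
      unfolding defs lift_homotopy_iff[OF N M gF(2,1) gd(2) gF(4)] using assms(3)
      by (simp add: chain_homotopy_equivalence_def)
    have "d \<otimes>\<^bsub>E\<^esub> r \<oplus>\<^bsub>E\<^esub> (r \<otimes>\<^bsub>E\<^esub> d \<oplus>\<^bsub>E\<^esub> r \<otimes>\<^bsub>E\<^esub> r) = d' \<otimes>\<^bsub>E\<^esub> d'"
      unfolding d'_eq using squares(1) carr by (simp add: l_distr r_distr a_ac)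
    then show "d \<otimes>\<^bsub>E\<^esub> r \<oplus>\<^bsub>E\<^esub> (r \<otimes>\<^bsub>E\<^esub> d \<oplus>\<^bsub>E\<^esub> r \<otimes>\<^bsub>E\<^esub> r) = \<zero>\<^bsub>E\<^esub>"
      by (simp add: squares(3))
  qed (use carr units S_eq in \<open>auto simp: defs lift_id_comp[OF M M] lift_id_comp[OF M N]
      lift_id_comp[OF N M] lift_id_comp[OF N N] gF\<close>)

  \<comment> \<open>A factor \<open>S\<close> raises the filtration by one and all other factors
    preserve it. For products with several factors \<open>S\<close> a gain of one is enough and
    nothing more is recorded.\<close>
  have SG: "S \<otimes>\<^bsub>E\<^esub> g \<in> lifts (- 1) 1 N B snd M A \<iota>M" by (rule lifts_comp[OF N M M g S]) simp_all
  have SH: "S \<otimes>\<^bsub>E\<^esub> h \<in> lifts 0 1 M A fst M A \<iota>M" by (rule lifts_comp[OF M M M h S]) simp_all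
  have U: "U \<in> lifts 1 0 N B snd M A \<iota>M"
    unfolding U_def
    by (intro lifts_diff[OF N M] lifts_comp[OF N N M l g] lifts_comp[OF N M M g h]) simp_all
  have L0: "L0 \<in> lifts 1 0 N B snd N B \<iota>N"
    unfolding L0_def by (intro lifts_diff[OF N N] l lifts_comp[OF N M N U f]) simp_all
  have a: "a \<in> lifts 2 0 N B snd M A \<iota>M"
    unfolding a_def by (intro lifts_inv[OF N M] lifts_comp[OF N M M U h]) simp_all
  have lf: "l \<otimes>\<^bsub>E\<^esub> f \<in> lifts 1 0 M A fst N B \<iota>N" by (rule lifts_comp[OF M N N f l]) simp_all
  have fh: "f \<otimes>\<^bsub>E\<^esub> h \<in> lifts 1 0 M A fst N B \<iota>N" by (rule lifts_comp[OF M M N h f]) simp_all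
  have hh: "h \<otimes>\<^bsub>E\<^esub> h \<in> lifts 2 0 M A fst M A \<iota>M" by (rule lifts_comp[OF M M M h h]) simp_all
  have b0: "b0 \<in> lifts 2 0 M A fst N B \<iota>N"
    unfolding b0_def
    by (intro lifts_diff[OF M N] lifts_add[OF M N] lifts_comp[OF M N N lf l]
        lifts_comp[OF M M N hh f] lifts_comp[OF M N N fh l]) simp_all
  have z: "z \<in> lifts 2 0 M A fst M A \<iota>M"
    unfolding z_def
    by (intro lifts_diff[OF M M] lifts_add[OF M M] hh lifts_comp[OF M N M b0 g] lifts_comp[OF M N M f a]) simp_all
  have b: "b \<in> lifts 2 0 M A fst N B \<iota>N"
    unfolding b_def by (intro lifts_diff[OF M N] b0 lifts_comp[OF M M N z f]) simp_all
  have c: "c \<in> lifts 3 0 M A fst M A \<iota>M"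
    unfolding c_def by (intro lifts_inv[OF M M] lifts_comp[OF M M M z h]) simp_all
  have cSG: "c \<otimes>\<^bsub>E\<^esub> (S \<otimes>\<^bsub>E\<^esub> g) \<in> lifts 2 1 N B snd M A \<iota>M"
    by (rule lifts_comp[OF N M M SG c]) simp_all
  have Sa: "S \<otimes>\<^bsub>E\<^esub> a \<in> lifts 1 1 N B snd M A \<iota>M" by (rule lifts_comp[OF N M M a S]) simp_all
  have ScSG: "S \<otimes>\<^bsub>E\<^esub> (c \<otimes>\<^bsub>E\<^esub> (S \<otimes>\<^bsub>E\<^esub> g)) \<in> lifts 1 1 N B snd M A \<iota>M"
    by (rule lifts_comp[OF N M M cSG S]) simp_all
  \<comment> \<open>The names \<open>e'\<close>, \<open>F'\<close>, \<open>G'\<close>,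
    \<open>H'\<close>, \<open>L'\<close> now denote ring elements. Each differs from the lift of an
    unperturbed map by terms containing \<open>S\<close>, hence is the lift of a perturbation:
    \<open>dN'\<close>, \<open>F1\<close>, \<open>G1\<close>, \<open>H1\<close>,
    \<open>L1\<close>.\<close>
  have "f \<otimes>\<^bsub>E\<^esub> (S \<otimes>\<^bsub>E\<^esub> g) \<in> lifts (- 1) 1 N B snd N B \<iota>N"
    by (rule lifts_comp[OF N M N SG f]) simp_all
  then obtain dN' where dN': "dN' \<in> filtered_hom (- 1) N B N B"
    "lift (- 1) snd \<iota>N dN' = lift (- 1) snd \<iota>N dN \<oplus>\<^bsub>E\<^esub> f \<otimes>\<^bsub>E\<^esub> (S \<otimes>\<^bsub>E\<^esub> g)" "perturbation (- 1) N B N B dN dN'"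
    by (rule perturbation_exists[OF N N gd(2) e[unfolded e_def]])
  have dN'_lift: "lift (- 1) snd \<iota>N dN' = e'"
    by (simp add: dN'(2) e'_def flip: e_def)
  have "f \<otimes>\<^bsub>E\<^esub> (S \<otimes>\<^bsub>E\<^esub> h) \<in> lifts 0 1 M A fst N B \<iota>N"
    by (rule lifts_comp[OF M M N SH f]) simp_all
  then obtain F1 where F1: "F1 \<in> filtered_hom 0 M A N B"
    "lift 0 fst \<iota>N F1 = lift 0 fst \<iota>N F \<oplus>\<^bsub>E\<^esub> f \<otimes>\<^bsub>E\<^esub> (S \<otimes>\<^bsub>E\<^esub> h)" "perturbation 0 M A N B F F1"
    by (rule perturbation_exists[OF M N gF(1) f[unfolded f_def]])
  have F1_lift: "lift 0 fst \<iota>N F1 = F'"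
    by (simp add: F1(2) F'_def flip: f_def)
  have "h \<otimes>\<^bsub>E\<^esub> (S \<otimes>\<^bsub>E\<^esub> g) \<in> lifts 0 1 N B snd M A \<iota>M"
    by (rule lifts_comp[OF N M M SG h]) simp_all
  then obtain G1 where G1: "G1 \<in> filtered_hom 0 N B M A"
    "lift 0 snd \<iota>M G1 = lift 0 snd \<iota>M G \<oplus>\<^bsub>E\<^esub> h \<otimes>\<^bsub>E\<^esub> (S \<otimes>\<^bsub>E\<^esub> g)" "perturbation 0 N B M A G G1"
    by (rule perturbation_exists[OF N M gF(2) g[unfolded g_def]])
  have G1_lift: "lift 0 snd \<iota>M G1 = G'"
    by (simp add: G1(2) G'_def flip: g_def)
  have "h \<otimes>\<^bsub>E\<^esub> (S \<otimes>\<^bsub>E\<^esub> h) \<in> lifts 1 1 M A fst M A \<iota>M"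
    by (rule lifts_comp[OF M M M SH h]) simp_all
  then obtain H1 where H1: "H1 \<in> filtered_hom 1 M A M A"
    "lift 1 fst \<iota>M H1 = lift 1 fst \<iota>M H \<oplus>\<^bsub>E\<^esub> h \<otimes>\<^bsub>E\<^esub> (S \<otimes>\<^bsub>E\<^esub> h)" "perturbation 1 M A M A H H1"
    by (rule perturbation_exists[OF M M gF(3) h[unfolded h_def]])
  have H1_lift: "lift 1 fst \<iota>M H1 = H'"
    by (simp add: H1(2) H'_def flip: h_def)
  \<comment> \<open>The part of \<open>L'\<close> free of \<open>S\<close> is \<open>L0\<close>, so
    \<open>L1\<close> is a perturbation of the corrected homotopy.\<close>
  have corrected: "lift 1 snd \<iota>N (corrected_homotopy M N F G H L) = L0"
    unfolding L0_def U_def by (rule lift_corrected_homotopy(2)[OF M N gF, folded defs])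
  have "f \<otimes>\<^bsub>E\<^esub> (S \<otimes>\<^bsub>E\<^esub> a) \<oplus>\<^bsub>E\<^esub> b \<otimes>\<^bsub>E\<^esub> (S \<otimes>\<^bsub>E\<^esub> g) \<oplus>\<^bsub>E\<^esub> f \<otimes>\<^bsub>E\<^esub> (S \<otimes>\<^bsub>E\<^esub> (c \<otimes>\<^bsub>E\<^esub> (S \<otimes>\<^bsub>E\<^esub> g)))
      \<in> lifts 1 1 N B snd N B \<iota>N"
    by (intro lifts_add[OF N N] lifts_comp[OF N M N Sa f] lifts_comp[OF N M N SG b]
        lifts_comp[OF N M N ScSG f]) simp_all
  then obtain L1 where L1: "L1 \<in> filtered_hom 1 N B N B"
    "lift 1 snd \<iota>N L1 = lift 1 snd \<iota>N (corrected_homotopy M N F G H L) \<oplus>\<^bsub>E\<^esub>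
      (f \<otimes>\<^bsub>E\<^esub> (S \<otimes>\<^bsub>E\<^esub> a) \<oplus>\<^bsub>E\<^esub> b \<otimes>\<^bsub>E\<^esub> (S \<otimes>\<^bsub>E\<^esub> g) \<oplus>\<^bsub>E\<^esub> f \<otimes>\<^bsub>E\<^esub> (S \<otimes>\<^bsub>E\<^esub> (c \<otimes>\<^bsub>E\<^esub> (S \<otimes>\<^bsub>E\<^esub> g))))"
    "perturbation 1 N B N B (corrected_homotopy M N F G H L) L1"
    by (rule perturbation_exists[OF N N lift_corrected_homotopy(1)[OF M N gF] L0[folded corrected]])
  have L1_lift: "lift 1 snd \<iota>N L1 = L'"
    by (simp add: L1(2) L'_def corrected)

  have graded: "dN' \<in> graded_hom (- 1) N N" "F1 \<in> graded_hom 0 M N" "G1 \<in> graded_hom 0 N M"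
    "H1 \<in> graded_hom 1 M M" "L1 \<in> graded_hom 1 N N"
    using dN'(1) F1(1) G1(1) H1(1) L1(1) by (auto simp: filtered_hom_def)
  have "square_zero N dN'"
    using lift_square_iff[OF N graded(1)] e'_square[OF squares(2)] dN'_lift by simp
  moreover have "\<forall>n. \<forall>x\<in>carrier (M n). F1 (n - 1) (dM' n x) = dN' n (F1 n x)"
    using lift_chain_iff[OF M N graded(2) gd(3) graded(1)] F'_chain[folded d'_eq]
    by (simp add: F1_lift dN'_lift d'_def)
  moreover have "\<forall>n. \<forall>y\<in>carrier (N n). G1 (n - 1) (dN' n y) = dM' n (G1 n y)"
    using lift_chain_iff[OF N M graded(3) graded(1) gd(3)] G'_chain[folded d'_eq]
    by (simp add: G1_lift dN'_lift d'_def)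
  moreover have "\<forall>n. \<forall>x\<in>carrier (M n).
      G1 n (F1 n x) \<otimes>\<^bsub>M n\<^esub> inv\<^bsub>M n\<^esub> x = dM' (n + 1) (H1 n x) \<otimes>\<^bsub>M n\<^esub> H1 (n - 1) (dM' n x)"
    using lift_homotopy_iff[OF M N graded(2,3) gd(3) graded(4)] H'_homotopy[folded d'_eq]
    by (simp add: F1_lift G1_lift H1_lift p_def d'_def)
  moreover have "\<forall>n. \<forall>y\<in>carrier (N n).
      F1 n (G1 n y) \<otimes>\<^bsub>N n\<^esub> inv\<^bsub>N n\<^esub> y = dN' (n + 1) (L1 n y) \<otimes>\<^bsub>N n\<^esub> L1 (n - 1) (dN' n y)"
    using lift_homotopy_iff[OF N M graded(3,2,1,5)] L'_homotopy
    by (simp add: F1_lift G1_lift L1_lift dN'_lift q_def)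
  ultimately show ?thesis
    using dN'(1,3) F1(1,3) G1(1,3) H1(1,3) L1(1,3)
    unfolding differential_perturbation_def chain_homotopy_equivalence_def by blast
qed

end
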